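(* Let $M^2$ be a generalized torus of first type in $S^3$ whose Gauss curvature is not constant. Then $M^2$ is (locally, i.e. an open piece of) a Lawson torus $\mathcal M_\alpha$ for some $\alpha>0$, $\alpha\neq 1$, where $$\mathcal M_\alpha:\ l(x,y)=(\cos x\cos\alpha y,\ \cos x\sin\alpha y,\ \sin x\cos y,\ \sin x\sin y).$$
   Context: $\mathbb R^4$ carries the standard Euclidean inner product and $S^3$ is its unit sphere. A surface in $S^3$ is minimal if its mean curvature in $S^3$ (with respect to a unit normal $n$ orthogonal to the position vector and the tangent plane) vanishes. Principal lines are the lines of curvature of the surface in $S^3$; bisectrices of the principal lines are the curves making angle $\pi/4$ with both families of principal lines. A circle is a curve in $\mathbb R^4$ with constant first Frenet curvature and vanishing higher Frenet curvatures. A generalized torus of first type is a minimal surface in $S^3$ on which one of the families of bisectrices of the principal lines is a family of circles. All considerations are local. *)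

theory Defs
  imports "HOL-Analysis.Analysis"
begin

definition pdu :: "(real \<times> real \<Rightarrow> 'a::real_normed_vector) \<Rightarrow> real \<times> real \<Rightarrow> 'a" where
  "pdu g p = frechet_derivative g (at p) (1, 0)"

definition pdv :: "(real \<times> real \<Rightarrow> 'a::real_normed_vector) \<Rightarrow> real \<times> real \<Rightarrow> 'a" where
  "pdv g p = frechet_derivative g (at p) (0, 1)"

definition surf_smooth_on :: "(real \<times> real) set \<Rightarrow> (real \<times> real \<Rightarrow> 'a::real_normed_vector) \<Rightarrow> bool" where
  "surf_smooth_on U g \<longleftrightarrow>
     (\<forall>ds::bool list. \<forall>p\<in>U. (foldr (\<lambda>d h. if d then pdu h else pdv h) ds g) differentiable (at p))"

definition fE :: "(real \<times> real \<Rightarrow> real^4) \<Rightarrow> real \<times> real \<Rightarrow> real" where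
  "fE f p = pdu f p \<bullet> pdu f p"
definition fF :: "(real \<times> real \<Rightarrow> real^4) \<Rightarrow> real \<times> real \<Rightarrow> real" where
  "fF f p = pdu f p \<bullet> pdv f p"
definition fG :: "(real \<times> real \<Rightarrow> real^4) \<Rightarrow> real \<times> real \<Rightarrow> real" where
  "fG f p = pdv f p \<bullet> pdv f p"

definition sL :: "(real \<times> real \<Rightarrow> real^4) \<Rightarrow> (real \<times> real \<Rightarrow> real^4) \<Rightarrow> real \<times> real \<Rightarrow> real" where
  "sL f n p = pdu (pdu f) p \<bullet> n p"
definition sM :: "(real \<times> real \<Rightarrow> real^4) \<Rightarrow> (real \<times> real \<Rightarrow> real^4) \<Rightarrow> real \<times> real \<Rightarrow> real" where
  "sM f n p = pdv (pdu f) p \<bullet> n p"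
definition sN :: "(real \<times> real \<Rightarrow> real^4) \<Rightarrow> (real \<times> real \<Rightarrow> real^4) \<Rightarrow> real \<times> real \<Rightarrow> real" where
  "sN f n p = pdv (pdv f) p \<bullet> n p"

definition surface_in_S3 :: "(real \<times> real) set \<Rightarrow> (real \<times> real \<Rightarrow> real^4) \<Rightarrow> bool" where
  "surface_in_S3 U f \<longleftrightarrow> open U \<and> connected U \<and> U \<noteq> {} \<and> surf_smooth_on U f \<and>
     (\<forall>p\<in>U. norm (f p) = 1 \<and> fE f p * fG f p - (fF f p)\<^sup>2 > 0)"

definition unit_normal :: "(real \<times> real) set \<Rightarrow> (real \<times> real \<Rightarrow> real^4) \<Rightarrow> (real \<times> real \<Rightarrow> real^4) \<Rightarrow> bool" where
  "unit_normal U f n \<longleftrightarrow> (\<forall>p\<in>U. norm (n p) = 1 \<and> n p \<bullet> f p = 0 \<and> n p \<bullet> pdu f p = 0 \<and> n p \<bullet> pdv f p = 0)"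

text \<open>Minimal: mean curvature (E N - 2 F M + G L)/(2(EG - F^2)) vanishes.\<close>

definition minimal_in_S3 :: "(real \<times> real) set \<Rightarrow> (real \<times> real \<Rightarrow> real^4) \<Rightarrow> (real \<times> real \<Rightarrow> real^4) \<Rightarrow> bool" where
  "minimal_in_S3 U f n \<longleftrightarrow>
     (\<forall>p\<in>U. fE f p * sN f n p - 2 * fF f p * sM f n p + fG f p * sL f n p = 0)"

definition umbilic :: "(real \<times> real \<Rightarrow> real^4) \<Rightarrow> (real \<times> real \<Rightarrow> real^4) \<Rightarrow> real \<times> real \<Rightarrow> bool" where
  "umbilic f n p \<longleftrightarrow> (\<exists>c::real. sL f n p = c * fE f p \<and> sM f n p = c * fF f p \<and> sN f n p = c * fG f p)"

text \<open>Gauss curvature via the Gauss equation in S^3: K = 1 + k1 k2 = 1 + det II / det I.\<close>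

definition gauss_curv :: "(real \<times> real \<Rightarrow> real^4) \<Rightarrow> (real \<times> real \<Rightarrow> real^4) \<Rightarrow> real \<times> real \<Rightarrow> real" where
  "gauss_curv f n p = 1 + (sL f n p * sN f n p - (sM f n p)\<^sup>2) / (fE f p * fG f p - (fF f p)\<^sup>2)"

definition tangent :: "(real \<times> real \<Rightarrow> real^4) \<Rightarrow> real \<times> real \<Rightarrow> real \<times> real \<Rightarrow> real^4" where
  "tangent f p w = fst w *\<^sub>R pdu f p + snd w *\<^sub>R pdv f p"

text \<open>Principal direction w = (a,b): equation of lines of curvature, i.e. II(w) parallel to I(w)
  (w is an eigenvector of the shape operator).\<close>

definition principal_dir :: "(real \<times> real \<Rightarrow> real^4) \<Rightarrow> (real \<times> real \<Rightarrow> real^4) \<Rightarrow> real \<times> real \<Rightarrow> real \<times> real \<Rightarrow> bool" where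
  "principal_dir f n p w \<longleftrightarrow> w \<noteq> 0 \<and>
     (let a = fst w; b = snd w in
       (fE f p * a + fF f p * b) * (sM f n p * a + sN f n p * b)
       - (fF f p * a + fG f p * b) * (sL f n p * a + sM f n p * b) = 0)"

text \<open>Bisectrix direction: the tangent vector makes angle pi/4 with every principal direction
  (angle between lines: absolute value of the cosine equals cos(pi/4)).\<close>

definition bisector_dir :: "(real \<times> real \<Rightarrow> real^4) \<Rightarrow> (real \<times> real \<Rightarrow> real^4) \<Rightarrow> real \<times> real \<Rightarrow> real \<times> real \<Rightarrow> bool" where
  "bisector_dir f n p w \<longleftrightarrow> w \<noteq> 0 \<and>
     (\<forall>w'. principal_dir f n p w' \<longrightarrow>
        \<bar>tangent f p w \<bullet> tangent f p w'\<bar> = norm (tangent f p w) * norm (tangent f p w') * cos (pi / 4))"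

text \<open>A circle (arclength-parametrized curve on an open interval I): unit speed, constant first
  curvature kappa = |gamma''|, and vanishing torsion/higher curvatures, i.e. N' = -kappa T,
  equivalently gamma''' = -kappa^2 gamma'.\<close>

definition is_circle :: "real set \<Rightarrow> (real \<Rightarrow> real^4) \<Rightarrow> bool" where
  "is_circle I \<gamma> \<longleftrightarrow> (\<exists>\<kappa>::real. \<exists>g1 g2 g3. \<forall>t\<in>I.
      (\<gamma> has_vector_derivative g1 t) (at t) \<and> (g1 has_vector_derivative g2 t) (at t) \<and>
      (g2 has_vector_derivative g3 t) (at t) \<and>
      norm (g1 t) = 1 \<and> norm (g2 t) = \<kappa> \<and> g3 t = - (\<kappa>\<^sup>2 *\<^sub>R g1 t))"

text \<open>Generalized torus of first type: minimal surface in S^3 (free of umbilics so that principal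
  lines are defined) with a smooth field X of bisectrix directions (normalized to unit speed in R^4,
  selecting one of the two bisectrix families) all of whose integral curves are circles.\<close>

definition gen_torus_first_type :: "(real \<times> real) set \<Rightarrow> (real \<times> real \<Rightarrow> real^4) \<Rightarrow> (real \<times> real \<Rightarrow> real^4) \<Rightarrow> bool" where
  "gen_torus_first_type U f n \<longleftrightarrow>
     surface_in_S3 U f \<and> unit_normal U f n \<and> minimal_in_S3 U f n \<and> (\<forall>p\<in>U. \<not> umbilic f n p) \<and>
     (\<exists>X :: real \<times> real \<Rightarrow> real \<times> real. surf_smooth_on U X \<and>
        (\<forall>p\<in>U. bisector_dir f n p (X p) \<and> norm (tangent f p (X p)) = 1) \<and>
        (\<forall>(a::real) b (c :: real \<Rightarrow> real \<times> real). a < b \<longrightarrow>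
           (\<forall>t\<in>{a<..<b}. c t \<in> U \<and> (c has_vector_derivative X (c t)) (at t)) \<longrightarrow>
           is_circle {a<..<b} (f \<circ> c)))"

definition lawson :: "real \<Rightarrow> real \<times> real \<Rightarrow> real^4" where
  "lawson \<alpha> xy = (let x = fst xy; y = snd xy in
     vector [cos x * cos (\<alpha> * y), cos x * sin (\<alpha> * y), sin x * cos y, sin x * sin y])"

end

theory Submission
  imports Defs
begin

text \<open>The bisectrices are the asymptotic lines. The third derivative of an asymptotic line has normal
  component (geodesic curvature) times (nonzero torsion), whereas that of a circle is tangent, so the
  bisectrix circles are great circles and the surface is ruled. In the adapted frame
  \<open>f, e1 = X f, e2 = Y f, m = X e2\<close>, with \<open>\<omega> = \<langle>Y e1, e2\<rangle>\<close> and \<open>\<rho> = |m|\<^sup>2\<close>, the compatibility conditions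
  make \<open>\<omega>\<close> and \<open>\<rho>\<close> constant along \<open>Y\<close>, and \<open>\<rho> powr (-1/4) *\<^sub>R e2\<close> is the restriction of one constant skew
  map \<open>\<Omega>\<close> of \<open>\<real>\<^sup>4\<close>. Since \<open>\<Omega>\<^sup>2\<close> preserves the plane spanned by \<open>f, e1\<close>, the coordinates of \<open>f\<close> in the two invariant
  planes of \<open>\<Omega>\<close> are \<open>cos x\<close> and \<open>sin x\<close> times phases that rotate along \<open>Y\<close> at speeds proportional to
  the eigenvalues of \<open>\<Omega>\<close>; these speeds differ because the Gauss curvature is not constant.\<close>

subsection \<open>Smooth maps of two variables and directional derivatives\<close>

text \<open>The exponent -1/4 comes from two identities: the bracket of \<open>X\<close> and
  \<open>Y\<close> is \<open>- \<omega>\<close> times \<open>Y\<close>, and the derivative of \<rho>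
  along \<open>X\<close> is \<open>- 4 * \<omega> * \<rho>\<close>. So \<open>h\<close>, the power
  -1/4 of \<rho>, satisfies \<open>dirD X h = \<omega> * h\<close>, and \<open>h\<close> times
  \<open>Y\<close> commutes with \<open>X\<close>: the rulings are carried into each other by a
  motion, and this is why a constant skew map can be expected. Two obstacles shape the proof. The
  normal \<open>n\<close> is a pointwise choice without any continuity, so it is never
  differentiated; the smooth normal field \<open>m\<close> and the sign-free \<rho> take its place.
  The domain is connected but perhaps not simply connected, while a single isometry and a single
  parameter must serve all of it. Hence no global angle is built: the objects with global meaning
  are \<Omega> and the sign-free squares of directions. Angles are lifted on balls only, and what
  travels through \<open>U\<close> is the mere existence of a compatible pair of angles.\<close>

primrec smooth_upto :: "nat \<Rightarrow> (real \<times> real) set \<Rightarrow> (real \<times> real \<Rightarrow> 'a::real_normed_vector) \<Rightarrow> bool" where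
  "smooth_upto 0 U g \<longleftrightarrow> (\<forall>p\<in>U. g differentiable at p)"
| "smooth_upto (Suc k) U g \<longleftrightarrow>
     (\<forall>p\<in>U. g differentiable at p) \<and> smooth_upto k U (pdu g) \<and> smooth_upto k U (pdv g)"

lemma smooth_upto_differentiable:
  "smooth_upto k U g \<Longrightarrow> p \<in> U \<Longrightarrow> g differentiable at p"
  by (cases k) auto

lemma smooth_upto_Suc_imp: "smooth_upto (Suc k) U g \<Longrightarrow> smooth_upto k U g"
proof (induction k arbitrary: g)
  case (Suc k)
  then show ?case by (metis smooth_upto.simps(2))
qed simp

text \<open>The recursion of \<open>smooth_upto\<close> peels off the derivative taken first. Under
  \<open>foldr\<close> this is the last letter of the word, hence the splitting into
  \<open>ds @ [d]\<close>.\<close>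

lemma smooth_upto_iff_words:
  "smooth_upto k U g \<longleftrightarrow> (\<forall>ds::bool list. length ds \<le> k \<longrightarrow>
     (\<forall>p\<in>U. (foldr (\<lambda>d h. if d then pdu h else pdv h) ds g) differentiable (at p)))"
proof (induction k arbitrary: g)
  case 0
  then show ?case by simp
next
  case (Suc k)
  let ?F = "\<lambda>ds g. foldr (\<lambda>d h. if d then pdu h else pdv h) ds g"
  have "(\<forall>ds. length ds \<le> Suc k \<longrightarrow> (\<forall>p\<in>U. ?F ds g differentiable (at p))) \<longleftrightarrow>
     (\<forall>p\<in>U. g differentiable at p) \<and>
     (\<forall>ds d. length ds \<le> k \<longrightarrow> (\<forall>p\<in>U. ?F ds (if d then pdu g else pdv g) differentiable (at p)))"
    (is "?L \<longleftrightarrow> ?R")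
  proof (intro iffI conjI)
    assume L: ?L
    show "\<forall>p\<in>U. g differentiable at p"
      using L[rule_format, of "[]"] by simp
    show "\<forall>ds d. length ds \<le> k \<longrightarrow> (\<forall>p\<in>U. ?F ds (if d then pdu g else pdv g) differentiable (at p))"
    proof (intro allI impI)
      fix ds :: "bool list" and d
      assume "length ds \<le> k"
      then show "\<forall>p\<in>U. ?F ds (if d then pdu g else pdv g) differentiable (at p)"
        using L[rule_format, of "ds @ [d]"] by simp
    qed
  next
    assume R: ?R
    show ?L
    proof (intro allI impI)
      fix ds :: "bool list"
      assume len: "length ds \<le> Suc k"
      show "\<forall>p\<in>U. ?F ds g differentiable (at p)"
      proof (cases ds rule: rev_cases)
        case Nil
        then show ?thesis using R by simp
      next
        case (snoc es d)
        then show ?thesis using R len by simp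
      qed
    qed
  qed
  moreover have "(\<forall>ds d. length ds \<le> k \<longrightarrow> (\<forall>p\<in>U. ?F ds (if d then pdu g else pdv g) differentiable (at p)))
    \<longleftrightarrow> smooth_upto k U (pdu g) \<and> smooth_upto k U (pdv g)"
    unfolding Suc by (smt (verit))
  ultimately show ?case by simp
qed

lemma surf_smooth_on_iff: "surf_smooth_on U g \<longleftrightarrow> (\<forall>k. smooth_upto k U g)"
  unfolding surf_smooth_on_def smooth_upto_iff_words by blast

lemma surf_smooth_on_differentiable:
  "surf_smooth_on U g \<Longrightarrow> p \<in> U \<Longrightarrow> g differentiable at p"
  unfolding surf_smooth_on_iff using smooth_upto_differentiable by blast

lemma pd_eqI:
  assumes "(g has_derivative g') (at p)"
  shows "pdu g p = g' (1, 0)" "pdv g p = g' (0, 1)"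
  using frechet_derivative_at[OF assms] by (simp_all add: pdu_def pdv_def)

lemma has_derivative_cong_on:
  assumes "open U" "p \<in> U" "\<And>q. q \<in> U \<Longrightarrow> g q = h q"
  shows "(g has_derivative g') (at p) \<longleftrightarrow> (h has_derivative g') (at p)"
  using has_derivative_transform_within_open[of g g' p UNIV U h]
    has_derivative_transform_within_open[of h g' p UNIV U g] assms by auto

lemma differentiable_cong_on:
  assumes "open U" "p \<in> U" "\<And>q. q \<in> U \<Longrightarrow> g q = h q"
  shows "g differentiable (at p) \<longleftrightarrow> h differentiable (at p)"
  unfolding differentiable_def using has_derivative_cong_on[OF assms] by simp

lemma pd_cong:
  assumes "open U" "p \<in> U" "\<And>q. q \<in> U \<Longrightarrow> g q = h q"
  shows "pdu g p = pdu h p" "pdv g p = pdv h p"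
  using has_derivative_cong_on[OF assms] by (simp_all add: pdu_def pdv_def frechet_derivative_def)

text \<open>Rules such as the product rule identify \<open>pdu\<close> and \<open>pdv\<close> of a
  compound only at points of \<open>U\<close>. Openness makes this enough for all higher
  derivatives, which is how each closure proof below performs its induction step.\<close>

lemma smooth_upto_cong:
  assumes U: "open U" and eq: "\<And>q. q \<in> U \<Longrightarrow> g q = h q"
  shows "smooth_upto k U g \<longleftrightarrow> smooth_upto k U h"
proof -
  have "smooth_upto k U g \<Longrightarrow> smooth_upto k U h" if "\<And>q. q \<in> U \<Longrightarrow> g q = h q" for g h :: "real \<times> real \<Rightarrow> 'a"
    using that
  proof (induction k arbitrary: g h)
    case 0
    then show ?case
      using differentiable_cong_on[OF U _ 0(2)] by simp
  next
    case (Suc k)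
    have "\<forall>p\<in>U. h differentiable at p"
      using differentiable_cong_on[OF U _ Suc.prems(2)] Suc.prems(1) by simp
    moreover have "smooth_upto k U (pdu h)" "smooth_upto k U (pdv h)"
      using Suc.IH[of "pdu g" "pdu h"] Suc.IH[of "pdv g" "pdv h"] pd_cong[OF U _ Suc.prems(2)] Suc.prems(1)
      by auto
    ultimately show ?case by simp
  qed
  with eq show ?thesis by metis
qed

lemma surf_smooth_on_pd:
  assumes "surf_smooth_on U g"
  shows "surf_smooth_on U (pdu g)" "surf_smooth_on U (pdv g)"
  using assms unfolding surf_smooth_on_iff by (metis smooth_upto.simps(2))+

lemma has_derivative_pd:
  assumes "g differentiable at p"
  shows "(g has_derivative (\<lambda>w. fst w *\<^sub>R pdu g p + snd w *\<^sub>R pdv g p)) (at p)"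
proof -
  have d: "(g has_derivative frechet_derivative g (at p)) (at p)"
    using assms frechet_derivative_works by blast
  then have lin: "linear (frechet_derivative g (at p))"
    by (rule has_derivative_linear)
  have "frechet_derivative g (at p) w = fst w *\<^sub>R pdu g p + snd w *\<^sub>R pdv g p" for w
  proof -
    have w: "w = fst w *\<^sub>R (1, 0) + snd w *\<^sub>R (0, 1)" by (simp add: prod_eq_iff)
    show ?thesis unfolding pdu_def pdv_def
      by (subst w, simp only: linear_add[OF lin] linear_scale[OF lin])
  qed
  then have "frechet_derivative g (at p) = (\<lambda>w. fst w *\<^sub>R pdu g p + snd w *\<^sub>R pdv g p)" ..
  then show ?thesis using d by simp
qed

lemma smooth_upto_const: "smooth_upto k U (\<lambda>p. c)"
proof (induction k arbitrary: c)
  case (Suc k)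
  have "pdu (\<lambda>p::real\<times>real. c) = (\<lambda>p. 0)" "pdv (\<lambda>p::real\<times>real. c) = (\<lambda>p. 0)"
    by (auto simp: pd_eqI[OF has_derivative_const])
  then show ?case using Suc by simp
qed simp

lemma smooth_upto_add:
  assumes "open U" "smooth_upto k U g" "smooth_upto k U h"
  shows "smooth_upto k U (\<lambda>p. g p + h p)"
  using assms
proof (induction k arbitrary: g h)
  case (Suc k)
  have pd: "pdu (\<lambda>p. g p + h p) p = pdu g p + pdu h p" "pdv (\<lambda>p. g p + h p) p = pdv g p + pdv h p"
    if "p \<in> U" for p
    using pd_eqI[OF has_derivative_add[OF has_derivative_pd has_derivative_pd], of g p h] Suc.prems that
    by auto
  have "smooth_upto k U (pdu (\<lambda>p. g p + h p))" "smooth_upto k U (pdv (\<lambda>p. g p + h p))"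
    by (rule iffD2[OF smooth_upto_cong[OF \<open>open U\<close>]], erule pd, use Suc in auto)+
  then show ?case using Suc.prems by auto
qed auto

lemma has_derivative_bilinear_pd:
  assumes "bounded_bilinear B" "g differentiable at p" "h differentiable at p"
  shows "((\<lambda>p. B (g p) (h p)) has_derivative (\<lambda>w. B (g p) (fst w *\<^sub>R pdu h p + snd w *\<^sub>R pdv h p)
    + B (fst w *\<^sub>R pdu g p + snd w *\<^sub>R pdv g p) (h p))) (at p)"
  by (rule bounded_bilinear.FDERIV[OF assms(1) has_derivative_pd[OF assms(2)] has_derivative_pd[OF assms(3)]])

lemma smooth_upto_bilinear:
  assumes B: "bounded_bilinear B" and U: "open U" and "smooth_upto k U g" "smooth_upto k U h"
  shows "smooth_upto k U (\<lambda>p. B (g p) (h p))"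
  using assms(3,4)
proof (induction k arbitrary: g h)
  case 0
  have "(\<lambda>p. B (g p) (h p)) differentiable at p" if "p \<in> U" for p
    by (rule differentiableI, rule has_derivative_bilinear_pd[OF B]) (use 0 that in auto)
  then show ?case by simp
next
  case (Suc k)
  have der: "((\<lambda>p. B (g p) (h p)) has_derivative (\<lambda>w. B (g p) (fst w *\<^sub>R pdu h p + snd w *\<^sub>R pdv h p)
    + B (fst w *\<^sub>R pdu g p + snd w *\<^sub>R pdv g p) (h p))) (at p)" if "p \<in> U" for p
    by (rule has_derivative_bilinear_pd[OF B]) (use Suc.prems that in auto)
  have pd: "pdu (\<lambda>p. B (g p) (h p)) p = B (g p) (pdu h p) + B (pdu g p) (h p)"
     "pdv (\<lambda>p. B (g p) (h p)) p = B (g p) (pdv h p) + B (pdv g p) (h p)"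
    if "p \<in> U" for p
    using pd_eqI[OF der[OF that]] by auto
  have g: "smooth_upto k U g" and h: "smooth_upto k U h"
    using Suc.prems smooth_upto_Suc_imp by blast+
  have "smooth_upto k U (pdu (\<lambda>p. B (g p) (h p)))" "smooth_upto k U (pdv (\<lambda>p. B (g p) (h p)))"
    by (rule iffD2[OF smooth_upto_cong[OF U]], erule pd,
      rule smooth_upto_add[OF U]; rule Suc.IH; use Suc.prems g h in simp)+
  moreover have "\<forall>p\<in>U. (\<lambda>p. B (g p) (h p)) differentiable at p"
    using der differentiableI by blast
  ultimately show ?case by simp
qed

lemma has_derivative_powr_pd:
  fixes g :: "real \<times> real \<Rightarrow> real"
  assumes "g differentiable at p" "g p > 0"
  shows "((\<lambda>p. g p powr r) has_derivative
    (\<lambda>w. (fst w *\<^sub>R pdu g p + snd w *\<^sub>R pdv g p) * (r * g p powr (r - 1)))) (at p)"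
proof -
  have "((\<lambda>z. z powr r) has_derivative (\<lambda>t. t * (r * g p powr (r - 1)))) (at (g p))"
    using has_real_derivative_powr[OF assms(2), of r]
    by (simp add: has_field_derivative_def mult.commute mult_commute_abs)
  from has_derivative_compose[OF has_derivative_pd[OF assms(1)] this] show ?thesis .
qed

text \<open>Differentiation lowers the exponent by one, so the induction on the order must run over
  all exponents at once.\<close>

lemma smooth_upto_powr:
  fixes g :: "real \<times> real \<Rightarrow> real"
  assumes U: "open U" and "smooth_upto k U g" and pos: "\<And>p. p \<in> U \<Longrightarrow> g p > 0"
  shows "smooth_upto k U (\<lambda>p. g p powr r)"
  using assms(2)
proof (induction k arbitrary: r)
  case 0
  have "(\<lambda>p. g p powr r) differentiable at p" if "p \<in> U" for p
    by (rule differentiableI, rule has_derivative_powr_pd) (use 0 that pos in auto)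
  then show ?case by simp
next
  case (Suc k)
  have der: "((\<lambda>p. g p powr r) has_derivative
      (\<lambda>w. (fst w *\<^sub>R pdu g p + snd w *\<^sub>R pdv g p) * (r * g p powr (r - 1)))) (at p)" if "p \<in> U" for p
    by (rule has_derivative_powr_pd) (use Suc.prems that pos in auto)
  have pd: "pdu (\<lambda>p. g p powr r) p = pdu g p * (r * g p powr (r - 1))"
     "pdv (\<lambda>p. g p powr r) p = pdv g p * (r * g p powr (r - 1))"
    if "p \<in> U" for p
    using pd_eqI[OF der[OF that]] by auto
  have "smooth_upto k U (pdu (\<lambda>p. g p powr r))" "smooth_upto k U (pdv (\<lambda>p. g p powr r))"
    by (rule iffD2[OF smooth_upto_cong[OF U]], erule pd,
      use Suc.prems Suc.IH[OF smooth_upto_Suc_imp[OF Suc.prems]] in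
        \<open>auto intro!: smooth_upto_bilinear[OF bounded_bilinear_mult U] smooth_upto_const\<close>)+
  moreover have "\<forall>p\<in>U. (\<lambda>p. g p powr r) differentiable at p"
    using der differentiableI by blast
  ultimately show ?case by simp
qed

context
  fixes U :: "(real \<times> real) set"
  assumes U: "open U"
begin

lemma surf_smooth_on_const: "surf_smooth_on U (\<lambda>p. c)"
  by (simp add: surf_smooth_on_iff smooth_upto_const)

lemma surf_smooth_on_add:
  "surf_smooth_on U g \<Longrightarrow> surf_smooth_on U h \<Longrightarrow> surf_smooth_on U (\<lambda>p. g p + h p)"
  by (simp add: surf_smooth_on_iff smooth_upto_add U)

lemma surf_smooth_on_bilinear:
  "bounded_bilinear B \<Longrightarrow> surf_smooth_on U g \<Longrightarrow> surf_smooth_on U h \<Longrightarrow> surf_smooth_on U (\<lambda>p. B (g p) (h p))"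
  by (simp add: surf_smooth_on_iff smooth_upto_bilinear U)

lemmas surf_smooth_on_scaleR = surf_smooth_on_bilinear[OF bounded_bilinear_scaleR]
lemmas surf_smooth_on_inner = surf_smooth_on_bilinear[OF bounded_bilinear_inner]
lemmas surf_smooth_on_mult = surf_smooth_on_bilinear[OF bounded_bilinear_mult]

lemma surf_smooth_on_linear:
  assumes "bounded_linear A" "surf_smooth_on U g"
  shows "surf_smooth_on U (\<lambda>p. A (g p))"
proof -
  \<comment> \<open>A linear map is a bilinear one with its scalar argument frozen at 1, so the
    bilinear case applies.\<close>
  have "bounded_bilinear (\<lambda>x (r::real). r *\<^sub>R A x)"
    using bounded_bilinear.comp[OF bounded_bilinear.flip[OF bounded_bilinear_scaleR] assms(1) bounded_linear_ident] .
  from surf_smooth_on_bilinear[OF this assms(2) surf_smooth_on_const[of 1]] show ?thesis by simp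
qed

lemmas surf_smooth_on_fst = surf_smooth_on_linear[OF bounded_linear_fst]
lemmas surf_smooth_on_snd = surf_smooth_on_linear[OF bounded_linear_snd]

lemma surf_smooth_on_minus: "surf_smooth_on U g \<Longrightarrow> surf_smooth_on U (\<lambda>p. - g p)"
  by (rule surf_smooth_on_linear[OF bounded_linear_minus[OF bounded_linear_ident]])

lemma surf_smooth_on_diff:
  "surf_smooth_on U g \<Longrightarrow> surf_smooth_on U h \<Longrightarrow> surf_smooth_on U (\<lambda>p. g p - h p)"
  using surf_smooth_on_add[OF _ surf_smooth_on_minus, of g h] by simp

lemma surf_smooth_on_Pair:
  assumes "surf_smooth_on U g" "surf_smooth_on U h"
  shows "surf_smooth_on U (\<lambda>p. (g p, h p))"
proof -
  have "bounded_linear (\<lambda>x. (x, 0))" "bounded_linear (\<lambda>y. (0, y))"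
    by (auto intro!: bounded_linear_Pair bounded_linear_ident bounded_linear_zero)
  then show ?thesis
    using surf_smooth_on_add[OF surf_smooth_on_linear[OF _ assms(1)] surf_smooth_on_linear[OF _ assms(2)]]
    by fastforce
qed

lemma surf_smooth_on_powr:
  fixes g :: "real \<times> real \<Rightarrow> real"
  shows "surf_smooth_on U g \<Longrightarrow> (\<And>p. p \<in> U \<Longrightarrow> g p > 0) \<Longrightarrow> surf_smooth_on U (\<lambda>p. g p powr r)"
  by (simp add: surf_smooth_on_iff smooth_upto_powr U)

end

section \<open>Derivatives along a vector field\<close>

definition dirD :: "(real \<times> real \<Rightarrow> real \<times> real) \<Rightarrow> (real \<times> real \<Rightarrow> 'a::real_normed_vector) \<Rightarrow> real \<times> real \<Rightarrow> 'a" where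
  "dirD V g p = fst (V p) *\<^sub>R pdu g p + snd (V p) *\<^sub>R pdv g p"

lemma dirD_eqI: "(g has_derivative g') (at p) \<Longrightarrow> dirD V g p = g' (V p)"
  using has_derivative_unique[OF has_derivative_pd, of g p g'] differentiableI[of g g' "at p"]
  unfolding dirD_def by metis

lemma dirD_cong: "open U \<Longrightarrow> p \<in> U \<Longrightarrow> (\<And>q. q \<in> U \<Longrightarrow> g q = h q) \<Longrightarrow> dirD V g p = dirD V h p"
  using pd_cong[of U p g h] by (simp add: dirD_def)

lemma dirD_const: "dirD V (\<lambda>p. c) p = 0"
  by (rule dirD_eqI) simp

lemma surf_smooth_on_dirD:
  "open U \<Longrightarrow> surf_smooth_on U V \<Longrightarrow> surf_smooth_on U g \<Longrightarrow> surf_smooth_on U (dirD V g)"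
  unfolding dirD_def[abs_def]
  by (intro surf_smooth_on_add surf_smooth_on_scaleR surf_smooth_on_fst surf_smooth_on_snd surf_smooth_on_pd)

lemma dirD_bilinear:
  assumes B: "bounded_bilinear B" and "g differentiable at p" "h differentiable at p"
  shows "dirD V (\<lambda>p. B (g p) (h p)) p = B (dirD V g p) (h p) + B (g p) (dirD V h p)"
  using dirD_eqI[OF has_derivative_bilinear_pd[OF assms]] unfolding dirD_def by (simp add: add.commute)

lemmas dirD_inner = dirD_bilinear[OF bounded_bilinear_inner]
lemmas dirD_scaleR = dirD_bilinear[OF bounded_bilinear_scaleR]
lemmas dirD_mult = dirD_bilinear[OF bounded_bilinear_mult]

lemma dirD_add:
  assumes "g differentiable at p" "h differentiable at p"
  shows "dirD V (\<lambda>p. g p + h p) p = dirD V g p + dirD V h p"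
  using dirD_eqI[OF has_derivative_add[OF has_derivative_pd[OF assms(1)] has_derivative_pd[OF assms(2)]]]
  unfolding dirD_def by simp

lemma dirD_minus:
  assumes "g differentiable at p"
  shows "dirD V (\<lambda>p. - g p) p = - dirD V g p"
  using dirD_eqI[OF has_derivative_minus[OF has_derivative_pd[OF assms(1)]]]
  unfolding dirD_def by simp

lemma dirD_diff:
  assumes "g differentiable at p" "h differentiable at p"
  shows "dirD V (\<lambda>p. g p - h p) p = dirD V g p - dirD V h p"
  using dirD_eqI[OF has_derivative_diff[OF has_derivative_pd[OF assms(1)] has_derivative_pd[OF assms(2)]]]
  unfolding dirD_def by simp

lemma dirD_powr:
  fixes g :: "real \<times> real \<Rightarrow> real"
  assumes "g differentiable at p" "g p > 0"
  shows "dirD V (\<lambda>p. g p powr r) p = r * g p powr (r - 1) * dirD V g p"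
  using dirD_eqI[OF has_derivative_powr_pd[OF assms]] by (simp add: dirD_def)

subsection \<open>Symmetry of mixed partials and commutators\<close>

text \<open>The mean value theorem in \<open>x\<close> reduces the second difference to an increment
  of \<open>gx\<close> in \<open>y\<close>; differentiability of \<open>gx\<close> at the single
  point \<open>(a, b)\<close> then evaluates it. The second difference is symmetric in the two
  variables, which is what makes mixed partials agree.\<close>

lemma second_difference_estimate:
  fixes g gx :: "real \<Rightarrow> real \<Rightarrow> real"
  assumes r: "r > 0"
    and gx: "\<And>x y. \<bar>x - a\<bar> < r \<Longrightarrow> \<bar>y - b\<bar> < r \<Longrightarrow> ((\<lambda>x. g x y) has_real_derivative gx x y) (at x)"
    and L: "((\<lambda>q. gx (fst q) (snd q)) has_derivative L) (at (a, b))"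
    and e: "e > 0"
  shows "\<exists>d>0. \<forall>t. 0 < t \<longrightarrow> t < d \<longrightarrow>
    \<bar>g (a + t) (b + t) - g (a + t) b - g a (b + t) + g a b - t\<^sup>2 * L (0, 1)\<bar> \<le> 3 * e * t\<^sup>2"
proof -
  from L e obtain d where d: "d > 0"
    and est: "\<And>q. norm (q - (a, b)) < d \<Longrightarrow>
      norm (gx (fst q) (snd q) - gx a b - L (q - (a, b))) \<le> e * norm (q - (a, b))"
    unfolding has_derivative_at_alt by (metis fst_conv snd_conv)
  have lin: "linear L" using L by (rule has_derivative_linear)
  have main: "\<bar>g (a + t) (b + t) - g (a + t) b - g a (b + t) + g a b - t\<^sup>2 * L (0, 1)\<bar> \<le> 3 * e * t\<^sup>2"
    if t: "0 < t" "t < min r (d / 2)" for t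
  proof -
    have der: "((\<lambda>x. g x (b + t) - g x b) has_real_derivative gx x (b + t) - gx x b) (at x)"
      if "a \<le> x" "x \<le> a + t" for x
      using that t by (auto intro!: DERIV_diff gx)
    obtain z where z: "a < z" "z < a + t"
      "(g (a + t) (b + t) - g (a + t) b) - (g a (b + t) - g a b) = (a + t - a) * (gx z (b + t) - gx z b)"
      using MVT2[OF _ der, of a "a + t"] t by auto
    \<comment> \<open>The two points at which \<open>gx\<close> is evaluated lie within
      \<open>2 * t\<close> and \<open>t\<close> of \<open>(a, b)\<close>; the errors add up to the
      factor 3.\<close>
    have n1: "norm (z - a, t) \<le> 2 * t" "norm (z - a, 0::real) \<le> t"
      using norm_Pair_le[of "z - a" t] norm_Pair_le[of "z - a" "0::real"] z t by auto
    have e1: "\<bar>gx z (b + t) - gx a b - L (z - a, t)\<bar> \<le> e * (2 * t)"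
      using est[of "(z, b + t)"] n1(1) t order_trans[OF _ mult_left_mono[OF n1(1), of e]] e by simp
    have e2: "\<bar>gx z b - gx a b - L (z - a, 0)\<bar> \<le> e * t"
      using est[of "(z, b)"] n1(2) t order_trans[OF _ mult_left_mono[OF n1(2), of e]] e by simp
    have "L (z - a, t) = L ((z - a, 0) + t *\<^sub>R (0, 1))" by simp
    also have "\<dots> = L (z - a, 0) + t * L (0, 1)"
      by (simp only: linear_add[OF lin] linear_scale[OF lin] real_scaleR_def)
    finally have "\<bar>gx z (b + t) - gx z b - t * L (0, 1)\<bar> \<le> 3 * e * t"
      using e1 e2 by linarith
    then have "t * \<bar>gx z (b + t) - gx z b - t * L (0, 1)\<bar> \<le> t * (3 * e * t)"
      using t by (intro mult_left_mono) auto
    moreover have "t * \<bar>gx z (b + t) - gx z b - t * L (0, 1)\<bar> = \<bar>t * (gx z (b + t) - gx z b - t * L (0, 1))\<bar>"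
      using t by (simp add: abs_mult)
    moreover have "t * (gx z (b + t) - gx z b - t * L (0, 1)) =
        g (a + t) (b + t) - g (a + t) b - g a (b + t) + g a b - t\<^sup>2 * L (0, 1)"
      using z(3) by (simp add: algebra_simps power2_eq_square)
    ultimately show ?thesis by (simp add: power2_eq_square mult_ac)
  qed
  show ?thesis
    by (rule exI[of _ "min r (d / 2)"]) (use main r d in auto)
qed

lemma mixed_partials_real:
  fixes g :: "real \<times> real \<Rightarrow> real"
  assumes U: "open U" "p \<in> U" and g: "\<And>q. q \<in> U \<Longrightarrow> g differentiable at q"
    and gu: "pdu g differentiable at p" and gv: "pdv g differentiable at p"
  shows "pdv (pdu g) p = pdu (pdv g) p"
proof -
  obtain a b where p: "p = (a, b)" by (cases p)
  from U obtain r0 where r0: "r0 > 0" "ball p r0 \<subseteq> U"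
    by (meson openE)
  define r where "r = r0 / 2"
  have r: "r > 0" using r0 by (simp add: r_def)
  have inU: "(x, y) \<in> U" if "\<bar>x - a\<bar> < r" "\<bar>y - b\<bar> < r" for x y
  proof -
    have "norm ((x, y) - p) \<le> \<bar>x - a\<bar> + \<bar>y - b\<bar>"
      using norm_Pair_le[of "x - a" "y - b"] by (simp add: p)
    then have "(x, y) \<in> ball p r0"
      using that by (simp add: r_def dist_norm norm_minus_commute)
    then show ?thesis using r0 by blast
  qed
  have du: "((\<lambda>x. g (x, y)) has_real_derivative pdu g (x, y)) (at x)" if "(x, y) \<in> U" for x y
  proof -
    have "((\<lambda>x. (x, y)) has_derivative (\<lambda>t. (t, 0))) (at x)"
      by (auto intro!: derivative_eq_intros)
    from has_derivative_compose[OF this has_derivative_pd[OF g[OF that]]]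
    show ?thesis by (simp add: has_field_derivative_def mult.commute mult_commute_abs)
  qed
  have dv: "((\<lambda>y. g (x, y)) has_real_derivative pdv g (x, y)) (at y)" if "(x, y) \<in> U" for x y
  proof -
    have "((\<lambda>y. (x, y)) has_derivative (\<lambda>t. (0, t))) (at y)"
      by (auto intro!: derivative_eq_intros)
    from has_derivative_compose[OF this has_derivative_pd[OF g[OF that]]]
    show ?thesis by (simp add: has_field_derivative_def mult.commute mult_commute_abs)
  qed
  have Lu: "((\<lambda>q. pdu g (fst q, snd q)) has_derivative
      (\<lambda>w. fst w *\<^sub>R pdu (pdu g) p + snd w *\<^sub>R pdv (pdu g) p)) (at (a, b))"
    using has_derivative_pd[OF gu] by (simp add: p)
  have swap: "((\<lambda>q::real\<times>real. (snd q, fst q)) has_derivative (\<lambda>w. (snd w, fst w))) (at (b, a))"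
    by (auto intro!: derivative_eq_intros)
  have Lv: "((\<lambda>q. pdv g (snd q, fst q)) has_derivative
      (\<lambda>w. snd w *\<^sub>R pdu (pdv g) p + fst w *\<^sub>R pdv (pdv g) p)) (at (b, a))"
    using has_derivative_compose[OF swap, of "pdv g" "\<lambda>w. fst w *\<^sub>R pdu (pdv g) p + snd w *\<^sub>R pdv (pdv g) p"]
      has_derivative_pd[OF gv] by (simp add: p)
  have "\<bar>pdv (pdu g) p - pdu (pdv g) p\<bar> \<le> e" if e: "e > 0" for e
  proof -
    \<comment> \<open>The same second difference is estimated in both orders of the variables. Each
      error is \<open>3 * (e/6)\<close>, half of \<open>e\<close>, times the square of
      \<open>t\<close>.\<close>
    obtain d1 where d1: "d1 > 0" "\<And>t. 0 < t \<Longrightarrow> t < d1 \<Longrightarrow>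
      \<bar>g (a + t, b + t) - g (a + t, b) - g (a, b + t) + g (a, b) - t\<^sup>2 * pdv (pdu g) p\<bar> \<le> 3 * (e/6) * t\<^sup>2"
      using second_difference_estimate[OF r, of a b "\<lambda>x y. g (x, y)" "\<lambda>x y. pdu g (x, y)", OF _ Lu, of "e/6"] du inU e
      by auto
    obtain d2 where d2: "d2 > 0" "\<And>t. 0 < t \<Longrightarrow> t < d2 \<Longrightarrow>
      \<bar>g (a + t, b + t) - g (a, b + t) - g (a + t, b) + g (a, b) - t\<^sup>2 * pdu (pdv g) p\<bar> \<le> 3 * (e/6) * t\<^sup>2"
      using second_difference_estimate[OF r, of b a "\<lambda>y x. g (x, y)" "\<lambda>y x. pdv g (x, y)", OF _ Lv, of "e/6"] dv inU e
      by auto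
    define t where "t = min d1 d2 / 2"
    have t: "0 < t" "t < d1" "t < d2" using d1 d2 by (auto simp: t_def)
    have "\<bar>t\<^sup>2 * pdv (pdu g) p - t\<^sup>2 * pdu (pdv g) p\<bar> \<le> e * t\<^sup>2"
      using d1(2)[OF t(1,2)] d2(2)[OF t(1,3)] by linarith
    moreover have "t\<^sup>2 * \<bar>pdv (pdu g) p - pdu (pdv g) p\<bar> = \<bar>t\<^sup>2 * pdv (pdu g) p - t\<^sup>2 * pdu (pdv g) p\<bar>"
      by (simp add: right_diff_distrib[symmetric] abs_mult)
    ultimately have "t\<^sup>2 * \<bar>pdv (pdu g) p - pdu (pdv g) p\<bar> \<le> t\<^sup>2 * e"
      by (simp add: mult.commute)
    then show ?thesis using t by simp
  qed
  then have "\<bar>pdv (pdu g) p - pdu (pdv g) p\<bar> \<le> 0"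
    by (rule field_le_epsilon) simp
  then show ?thesis by simp
qed

lemma pd_bounded_linear:
  assumes "bounded_linear A" "g differentiable at p"
  shows "pdu (\<lambda>p. A (g p)) p = A (pdu g p)" "pdv (\<lambda>p. A (g p)) p = A (pdv g p)"
  using pd_eqI[OF bounded_linear.has_derivative[OF assms(1) has_derivative_pd[OF assms(2)]]] by simp_all

lemma dirD_bounded_linear:
  assumes "bounded_linear A" "g differentiable at p"
  shows "dirD V (\<lambda>p. A (g p)) p = A (dirD V g p)"
  using dirD_eqI[OF bounded_linear.has_derivative[OF assms(1) has_derivative_pd[OF assms(2)]]]
  by (simp add: dirD_def)

lemma mixed_partials:
  fixes g :: "real \<times> real \<Rightarrow> 'a::euclidean_space"
  assumes U: "open U" "p \<in> U" and g: "surf_smooth_on U g"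
  shows "pdv (pdu g) p = pdu (pdv g) p"
proof (rule euclidean_eqI)
  fix b :: 'a
  note lin = bounded_linear_inner_left[of b]
  have d: "q \<in> U \<Longrightarrow> g differentiable at q" "q \<in> U \<Longrightarrow> pdu g differentiable at q"
    "q \<in> U \<Longrightarrow> pdv g differentiable at q" for q
    using g surf_smooth_on_pd surf_smooth_on_differentiable by blast+
  have gb: "surf_smooth_on U (\<lambda>q. g q \<bullet> b)"
    by (rule surf_smooth_on_linear[OF U(1) lin g])
  have "pdv (pdu (\<lambda>q. g q \<bullet> b)) p = pdu (pdv (\<lambda>q. g q \<bullet> b)) p"
    by (rule mixed_partials_real[OF U])
      (use gb U surf_smooth_on_pd surf_smooth_on_differentiable in blast)+
  moreover have "pdv (pdu (\<lambda>q. g q \<bullet> b)) p = pdv (\<lambda>q. pdu g q \<bullet> b) p"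
    by (rule pd_cong[OF U]) (simp add: pd_bounded_linear[OF lin] d)
  moreover have "pdu (pdv (\<lambda>q. g q \<bullet> b)) p = pdu (\<lambda>q. pdv g q \<bullet> b) p"
    by (rule pd_cong[OF U]) (simp add: pd_bounded_linear[OF lin] d)
  ultimately show "pdv (pdu g) p \<bullet> b = pdu (pdv g) p \<bullet> b"
    using d U by (simp add: pd_bounded_linear[OF lin])
qed

lemma dirD_dirD:
  assumes U: "open U" "p \<in> U" and W: "surf_smooth_on U W" and g: "surf_smooth_on U g"
  shows "dirD V (dirD W g) p =
      (fst (W p) *\<^sub>R dirD V (pdu g) p + fst (dirD V W p) *\<^sub>R pdu g p) +
      (snd (W p) *\<^sub>R dirD V (pdv g) p + snd (dirD V W p) *\<^sub>R pdv g p)"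
proof -
  note d = surf_smooth_on_differentiable[OF _ U(2)]
  note sm = surf_smooth_on_pd[OF g] surf_smooth_on_fst[OF U(1)] surf_smooth_on_snd[OF U(1)]
    surf_smooth_on_scaleR[OF U(1)]
  have eq: "dirD W g = (\<lambda>p. fst (W p) *\<^sub>R pdu g p + snd (W p) *\<^sub>R pdv g p)"
    by (rule ext) (simp add: dirD_def)
  show ?thesis unfolding eq
    by (subst dirD_add; (intro d sm W)?; subst (1 2) dirD_scaleR; (intro d sm W)?)
      (simp add: dirD_bounded_linear[OF bounded_linear_fst d[OF W]]
        dirD_bounded_linear[OF bounded_linear_snd d[OF W]])
qed

text \<open>The field on the right is the Lie bracket in coordinates: \<open>X\<close> and
  \<open>Y\<close> are differentiated as pair-valued functions, and the second derivatives of
  \<open>g\<close> cancel by symmetry.\<close>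

lemma dirD_commutator:
  fixes g :: "real \<times> real \<Rightarrow> 'a::euclidean_space"
  assumes U: "open U" "p \<in> U"
    and X: "surf_smooth_on U X" and Y: "surf_smooth_on U Y" and g: "surf_smooth_on U g"
  shows "dirD X (dirD Y g) p - dirD Y (dirD X g) p = dirD (\<lambda>q. dirD X Y q - dirD Y X q) g p"
  unfolding dirD_dirD[OF U X g] dirD_dirD[OF U Y g]
  by (simp add: dirD_def[of _ "pdu g"] dirD_def[of _ "pdv g"] dirD_def[of _ g] mixed_partials[OF U g]
      algebra_simps)

text \<open>Cramer's rule: two independent directions determine both partial derivatives. This lets
  first integrals be checked along the frame alone.\<close>

lemma pd_zero_if_dirD_zero:
  assumes "dirD X g p = 0" "dirD Y g p = 0"
    and det: "fst (X p) * snd (Y p) - snd (X p) * fst (Y p) \<noteq> 0"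
  shows "pdu g p = 0" "pdv g p = 0"
proof -
  let ?D = "fst (X p) * snd (Y p) - snd (X p) * fst (Y p)"
  have "?D *\<^sub>R pdu g p = snd (Y p) *\<^sub>R dirD X g p - snd (X p) *\<^sub>R dirD Y g p"
    by (simp add: dirD_def algebra_simps)
  then show "pdu g p = 0" using assms by simp
  have "?D *\<^sub>R pdv g p = fst (X p) *\<^sub>R dirD Y g p - fst (Y p) *\<^sub>R dirD X g p"
    by (simp add: dirD_def algebra_simps)
  then show "pdv g p = 0" using assms by simp
qed

lemma constant_if_dirD_zero:
  assumes "open U" "connected U" and g: "\<And>p. p \<in> U \<Longrightarrow> g differentiable at p"
    and "\<And>p. p \<in> U \<Longrightarrow> dirD X g p = 0" "\<And>p. p \<in> U \<Longrightarrow> dirD Y g p = 0"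
    and "\<And>p. p \<in> U \<Longrightarrow> fst (X p) * snd (Y p) - snd (X p) * fst (Y p) \<noteq> 0"
    and "p \<in> U" "q \<in> U"
  shows "g p = g q"
proof (rule has_derivative_zero_unique_connected[OF assms(1,2) _ assms(7,8)])
  fix x assume "x \<in> U"
  then show "(g has_derivative (\<lambda>x. 0)) (at x)"
    using has_derivative_pd[OF g, of x] pd_zero_if_dirD_zero[of X g x Y] assms(4-6) by simp
qed

subsection \<open>Local existence of integral curves\<close>

text \<open>Picard iteration for a globally Lipschitz field, as a contraction on bounded continuous
  functions on the whole line.\<close>

lemma picard_global:
  fixes F :: "'a::euclidean_space \<Rightarrow> 'a"
  assumes L: "L \<ge> 0" "\<And>x y. norm (F x - F y) \<le> L * norm (x - y)"
  shows "\<exists>e>0. \<exists>u. u 0 = p \<and> continuous_on UNIV u \<and>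
    (\<forall>t\<in>{-e<..<e}. (u has_vector_derivative F (u t)) (at t))"
proof -
  \<comment> \<open>The contraction constant will be \<open>3 * e * L\<close>: an integral over
    length at most \<open>2 * e\<close>, and one over length \<open>e\<close> for the correction at
    time 0. This choice keeps it below 1.\<close>
  define e where "e = 1 / (3 * L + 1) / 2"
  have e: "e > 0" "3 * e * L < 1"
    using L(1) by (auto simp: e_def field_simps)
  have contF: "continuous_on S F" for S
    by (rule lipschitz_on_continuous_on[of L]) (use L in \<open>auto intro!: lipschitz_onI simp: dist_norm\<close>)
  \<comment> \<open>Integrating from \<open>-e\<close> handles both signs of time with one integral;
    subtracting \<open>I u 0\<close> later restores the initial value at time 0.\<close>
  define I where "I u t = integral {-e..t} (\<lambda>s. F (apply_bcontfun u s))" for u :: "real \<Rightarrow>\<^sub>C 'a" and t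
  have contFu: "continuous_on S (\<lambda>s. F (apply_bcontfun u s))" for S :: "real set" and u
    by (rule continuous_on_compose2[OF contF[of UNIV]]) auto
  have derI: "(I u has_vector_derivative F (apply_bcontfun u t)) (at t within {-e..e})"
    if "t \<in> {-e..e}" for u t
    unfolding I_def[abs_def] by (rule integral_has_vector_derivative[OF contFu that])
  have contI: "continuous_on {-e..e} (I u)" for u
    using derI by (metis continuous_on_eq_continuous_within has_vector_derivative_continuous)
  \<comment> \<open>The Picard image matters only on the interval from \<open>-e\<close> to
    \<open>e\<close>; clamping the time extends it as a bounded continuous function.\<close>
  have "\<exists>g. \<forall>x. apply_bcontfun g x = p + I u (clamp (-e) e x) - I u 0" for u
  proof -
    have "continuous_on (cbox (-e) e) (\<lambda>t. p + I u t - I u 0)"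
      using contI by (auto intro!: continuous_intros)
    then show ?thesis by (rule continuous_on_cbox_bcontfunE) blast
  qed
  then obtain T where T: "\<And>u x. apply_bcontfun (T u) x = p + I u (clamp (-e) e x) - I u 0"
    by metis
  have Idiff: "norm (I u t - I v t) \<le> L * dist u v * (t + e)" if t: "t \<in> {-e..e}" for u v t
  proof -
    have "I u t - I v t = integral {-e..t} (\<lambda>s. F (apply_bcontfun u s) - F (apply_bcontfun v s))"
      unfolding I_def by (rule Henstock_Kurzweil_Integration.integral_diff[symmetric])
        (auto intro!: integrable_continuous_real contFu)
    also have "norm \<dots> \<le> L * dist u v * (t - - e)"
    proof (rule integral_bound)
      show "- e \<le> t" using t by simp
      show "continuous_on {- e..t} (\<lambda>s. F (apply_bcontfun u s) - F (apply_bcontfun v s))"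
        by (intro continuous_on_diff contFu)
      show "norm (F (apply_bcontfun u s) - F (apply_bcontfun v s)) \<le> L * dist u v" for s
        using L(2)[of "apply_bcontfun u s" "apply_bcontfun v s"]
          mult_left_mono[OF dist_bounded[of u s v] L(1)] by (simp add: dist_norm)
    qed
    finally show ?thesis by simp
  qed
  have "dist (T u) (T v) \<le> (3 * e * L) * dist u v" for u v
  proof (rule dist_bound)
    fix x
    have c: "clamp (-e) e x \<in> {-e..e}" using clamp_in_interval[of "-e" e x] e by simp
    have "dist (apply_bcontfun (T u) x) (apply_bcontfun (T v) x) =
        norm ((I u (clamp (-e) e x) - I v (clamp (-e) e x)) - (I u 0 - I v 0))"
      by (simp add: T dist_norm algebra_simps)
    also have "\<dots> \<le> L * dist u v * (clamp (-e) e x + e) + L * dist u v * (0 + e)"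
      by (rule order_trans[OF norm_triangle_ineq4]) (use Idiff[OF c, of u v] Idiff[of 0 u v] e in auto)
    also have "\<dots> \<le> L * dist u v * (2 * e) + L * dist u v * (0 + e)"
      using c L(1) by (intro add_mono mult_left_mono) auto
    finally show "dist (apply_bcontfun (T u) x) (apply_bcontfun (T v) x) \<le> (3 * e * L) * dist u v"
      by (simp add: algebra_simps)
  qed
  then have "\<exists>!u. T u = u"
    using e L(1) by (intro banach_fix_type[of "3 * e * L"]) auto
  then obtain u where u: "T u = u" by blast
  have ueq: "apply_bcontfun u t = p + I u t - I u 0" if "t \<in> {-e..e}" for t
    using T[of u t] clamp_cancel_cbox[of t "-e" e] that by (simp add: u)
  have "(apply_bcontfun u has_vector_derivative F (apply_bcontfun u t)) (at t)" if t: "t \<in> {-e<..<e}" for t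
  proof -
    have "(I u has_vector_derivative F (apply_bcontfun u t)) (at t)"
      using derI[of t u] t has_vector_derivative_within_open[of t "{-e<..<e}"]
      by (meson atLeastAtMost_iff greaterThanLessThan_iff greaterThanLessThan_subseteq_atLeastAtMost_iff
          has_vector_derivative_within_subset less_imp_le open_greaterThanLessThan order_refl)
    then have "((\<lambda>t. p + I u t - I u 0) has_vector_derivative F (apply_bcontfun u t)) (at t)"
      by (auto intro!: derivative_eq_intros)
    then show ?thesis
      by (rule has_vector_derivative_transform_within_open[where S = "{-e<..<e}"]) (use ueq t in auto)
  qed
  moreover have "apply_bcontfun u 0 = p" using ueq[of 0] e by simp
  ultimately show ?thesis using e
    by (intro exI[of _ e] conjI exI[of _ "apply_bcontfun u"]) auto
qed

lemma integral_curve_exists: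
  assumes U: "open U" "p \<in> U" and X: "surf_smooth_on U X"
  shows "\<exists>e>0. \<exists>c. c 0 = p \<and> (\<forall>t\<in>{-e<..<e}. c t \<in> U \<and> (c has_vector_derivative X (c t)) (at t))"
proof -
  obtain r where r: "r > 0" "cball p r \<subseteq> U" using U by (meson open_contains_cball)
  let ?B = "cball p r"
  have sm: "surf_smooth_on U (pdu X)" "surf_smooth_on U (pdv X)" using surf_smooth_on_pd[OF X] .
  have cont: "continuous_on ?B (pdu X)" "continuous_on ?B (pdv X)"
    by (intro differentiable_imp_continuous_on; 
        use sm surf_smooth_on_differentiable r differentiable_at_imp_differentiable_on in blast)+
  obtain K1 where K1: "\<And>x. x \<in> ?B \<Longrightarrow> norm (pdu X x) \<le> K1"
    using compact_imp_bounded[OF compact_continuous_image[OF cont(1) compact_cball]]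
    unfolding bounded_iff by blast
  obtain K2 where K2: "\<And>x. x \<in> ?B \<Longrightarrow> norm (pdv X x) \<le> K2"
    using compact_imp_bounded[OF compact_continuous_image[OF cont(2) compact_cball]]
    unfolding bounded_iff by blast
  define L where "L = K1 + K2"
  have K: "K1 \<ge> 0" "K2 \<ge> 0"
    using K1[of p] K2[of p] r by (auto intro: order_trans[OF norm_ge_zero])
  have lip: "norm (X x - X y) \<le> L * norm (x - y)" if "x \<in> ?B" "y \<in> ?B" for x y
  proof (rule differentiable_bound[of ?B X "\<lambda>x w. fst w *\<^sub>R pdu X x + snd w *\<^sub>R pdv X x"])
    fix x assume x: "x \<in> ?B"
    show "(X has_derivative (\<lambda>w. fst w *\<^sub>R pdu X x + snd w *\<^sub>R pdv X x)) (at x within ?B)"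
      using has_derivative_pd[OF surf_smooth_on_differentiable[OF X]] x r
      by (meson has_derivative_at_withinI subset_eq)
    show "onorm (\<lambda>w. fst w *\<^sub>R pdu X x + snd w *\<^sub>R pdv X x) \<le> L"
    proof (rule onorm_bound)
      show "0 \<le> L" using K by (simp add: L_def)
      fix w :: "real \<times> real"
      have "norm (fst w *\<^sub>R pdu X x + snd w *\<^sub>R pdv X x) \<le> \<bar>fst w\<bar> * norm (pdu X x) + \<bar>snd w\<bar> * norm (pdv X x)"
        by (rule order_trans[OF norm_triangle_ineq]) simp
      also have "\<dots> \<le> norm w * K1 + norm w * K2"
        using norm_fst_le[of "fst w" "snd w"] norm_snd_le[of "snd w" "fst w"] K1[OF x] K2[OF x] K
        by (intro add_mono mult_mono) auto
      finally show "norm (fst w *\<^sub>R pdu X x + snd w *\<^sub>R pdv X x) \<le> L * norm w"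
        by (simp add: L_def algebra_simps)
    qed
  qed (use that in auto)
  \<comment> \<open>Projection to the closed ball is 1-Lipschitz, so \<open>F\<close> is a global
    Lipschitz extension of \<open>X\<close> restricted to the ball. By continuity its solution stays
    inside for a short time and there solves the original equation.\<close>
  define F where "F x = X (closest_point ?B x)" for x
  have ne: "?B \<noteq> {}" using r by auto
  have "norm (F x - F y) \<le> L * norm (x - y)" for x y
  proof -
    have "norm (F x - F y) \<le> L * norm (closest_point ?B x - closest_point ?B y)"
      unfolding F_def by (rule lip; rule closest_point_in_set; use ne in auto)
    also have "\<dots> \<le> L * norm (x - y)"
      using closest_point_lipschitz[of ?B x y] ne K
      by (intro mult_left_mono) (auto simp: dist_norm L_def)
    finally show ?thesis .
  qed
  moreover have "L \<ge> 0" using K by (simp add: L_def)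
  ultimately obtain e u where u: "e > 0" "u 0 = p" "continuous_on UNIV u"
      "\<And>t. t \<in> {-e<..<e} \<Longrightarrow> (u has_vector_derivative F (u t)) (at t)"
    using picard_global[of L F p] by blast
  have "open (u -` ball p r)"
    using u(3) by (simp add: continuous_on_open_vimage open_vimage)
  moreover have "0 \<in> u -` ball p r" using u r by simp
  ultimately obtain d where d: "d > 0" "ball 0 d \<subseteq> u -` ball p r"
    by (meson openE)
  show ?thesis
  proof (intro exI conjI ballI)
    show "min e d > 0" using u d by simp
    show "u 0 = p" by (rule u)
    fix t assume t: "t \<in> {-min e d<..<min e d}"
    then have "t \<in> {-e<..<e}" "t \<in> ball 0 d"
      by (auto simp: dist_norm abs_less_iff min_def split: if_splits)
    then have b: "u t \<in> ball p r" using d(2) by blast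
    then show "u t \<in> U" using r by auto
    have "F (u t) = X (u t)" using b by (simp add: F_def closest_point_self)
    then show "(u has_vector_derivative X (u t)) (at t)" using u(4)[of t] \<open>t \<in> {-e<..<e}\<close> by simp
  qed
qed

subsection \<open>Asymptotic bisectrices and circles\<close>

text \<open>Pointwise algebra behind "bisectrices of a minimal surface are asymptotic". Here
  \<open>(a, b)\<close> is the unit bisectrix and \<open>(c, d)\<close> is it turned by a right
  angle. In this orthonormal basis the second form has rows \<open>(l, m)\<close> and
  \<open>(m, - l)\<close> by minimality; since every eigenvector must have components of equal
  absolute value, \<open>l\<close> vanishes and \<open>m\<close> does not.\<close>

lemma asymptotic_bisectrix:
  fixes E F G L M N a b c d :: real
  assumes D: "E * G - F\<^sup>2 > 0" and min: "E * N - 2 * F * M + G * L = 0"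
    and unit: "E * a\<^sup>2 + 2 * F * a * b + G * b\<^sup>2 = 1"
    and k: "k > 0" "k\<^sup>2 * (E * G - F\<^sup>2) = 1"
    and c: "c = - (F * a + G * b) * k" and d: "d = (E * a + F * b) * k"
    and bis: "\<And>a' b'. (a', b') \<noteq> (0, 0) \<Longrightarrow>
      (E * a' + F * b') * (M * a' + N * b') - (F * a' + G * b') * (L * a' + M * b') = 0 \<Longrightarrow>
      2 * (E * a * a' + F * (a * b' + b * a') + G * b * b')\<^sup>2 = E * a'\<^sup>2 + 2 * F * a' * b' + G * b'\<^sup>2"
  shows "L * a\<^sup>2 + 2 * M * a * b + N * b\<^sup>2 = 0" "L * c\<^sup>2 + 2 * M * c * d + N * d\<^sup>2 = 0"
    "L * a * c + M * (a * d + b * c) + N * b * d \<noteq> 0"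
    "E * a * c + F * (a * d + b * c) + G * b * d = 0" "E * c\<^sup>2 + 2 * F * c * d + G * d\<^sup>2 = 1"
    "a * d - b * c = k"
    "L * N - M\<^sup>2 = - (L * a * c + M * (a * d + b * c) + N * b * d)\<^sup>2 * (E * G - F\<^sup>2)"
proof -
  define l where "l = L * a\<^sup>2 + 2 * M * a * b + N * b\<^sup>2"
  define l' where "l' = L * c\<^sup>2 + 2 * M * c * d + N * d\<^sup>2"
  define m where "m = L * a * c + M * (a * d + b * c) + N * b * d"
  show orth: "E * a * c + F * (a * d + b * c) + G * b * d = 0"
    unfolding c d by algebra
  have "E * c\<^sup>2 + 2 * F * c * d + G * d\<^sup>2 = k\<^sup>2 * (E * G - F\<^sup>2) * (E * a\<^sup>2 + 2 * F * a * b + G * b\<^sup>2)"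
    unfolding c d by algebra
  then show unit': "E * c\<^sup>2 + 2 * F * c * d + G * d\<^sup>2 = 1" using unit k by simp
  have "a * d - b * c = k * (E * a\<^sup>2 + 2 * F * a * b + G * b\<^sup>2)"
    unfolding c d by algebra
  then show det: "a * d - b * c = k" using unit by simp
  \<comment> \<open>Completeness of an orthonormal pair: the sum of the squares of the two vectors,
    as symmetric matrices, is the inverse of the first fundamental form. It turns the minimality
    equation into the trace \<open>l + l'\<close>.\<close>
  have "a\<^sup>2 + c\<^sup>2 = k\<^sup>2 * G * (E * a\<^sup>2 + 2 * F * a * b + G * b\<^sup>2)"
    "a * b + c * d = - k\<^sup>2 * F * (E * a\<^sup>2 + 2 * F * a * b + G * b\<^sup>2)"
    "b\<^sup>2 + d\<^sup>2 = k\<^sup>2 * E * (E * a\<^sup>2 + 2 * F * a * b + G * b\<^sup>2)"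
    using k(2) unfolding c d by algebra+
  then have inv: "a\<^sup>2 + c\<^sup>2 = k\<^sup>2 * G" "a * b + c * d = - k\<^sup>2 * F" "b\<^sup>2 + d\<^sup>2 = k\<^sup>2 * E"
    using unit by simp_all
  have "l + l' = L * (a\<^sup>2 + c\<^sup>2) + 2 * M * (a * b + c * d) + N * (b\<^sup>2 + d\<^sup>2)"
    unfolding l_def l'_def by algebra
  also have "\<dots> = k\<^sup>2 * (E * N - 2 * F * M + G * L)" unfolding inv by algebra
  finally have l': "l' = - l" using min by simp
  have key: "x\<^sup>2 = y\<^sup>2" if xy: "(x, y) \<noteq> (0, 0)" and eq: "m * (x\<^sup>2 - y\<^sup>2) - 2 * l * x * y = 0" for x y
  proof -
    define a' where "a' = x * a + y * c"
    define b' where "b' = x * b + y * d"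
    have Ix: "E * a * a' + F * (a * b' + b * a') + G * b * b' = x"
    proof -
      have "E * a * a' + F * (a * b' + b * a') + G * b * b' =
        x * (E * a\<^sup>2 + 2 * F * a * b + G * b\<^sup>2) + y * (E * a * c + F * (a * d + b * c) + G * b * d)"
        unfolding a'_def b'_def by algebra
      then show ?thesis using unit orth by simp
    qed
    have Iy: "E * c * a' + F * (c * b' + d * a') + G * d * b' = y"
    proof -
      have "E * c * a' + F * (c * b' + d * a') + G * d * b' =
        y * (E * c\<^sup>2 + 2 * F * c * d + G * d\<^sup>2) + x * (E * a * c + F * (a * d + b * c) + G * b * d)"
        unfolding a'_def b'_def by algebra
      then show ?thesis using unit' orth by simp
    qed
    have nz: "(a', b') \<noteq> (0, 0)" using Ix Iy xy by auto
    have len: "E * a'\<^sup>2 + 2 * F * a' * b' + G * b'\<^sup>2 = x\<^sup>2 + y\<^sup>2"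
    proof -
      have "E * a'\<^sup>2 + 2 * F * a' * b' + G * b'\<^sup>2 =
        x * (E * a * a' + F * (a * b' + b * a') + G * b * b') + y * (E * c * a' + F * (c * b' + d * a') + G * d * b')"
        unfolding a'_def b'_def by algebra
      then show ?thesis unfolding Ix Iy by (simp add: power2_eq_square)
    qed
    \<comment> \<open>Up to the nonzero determinant, the equation of principal directions compares
      the ratio of the two components of \<open>w\<close> with that of its image under the shape
      operator, both taken in the orthonormal basis.\<close>
    have "(a * d - b * c) * ((E * a' + F * b') * (M * a' + N * b') - (F * a' + G * b') * (L * a' + M * b')) =
      (E * a * a' + F * (a * b' + b * a') + G * b * b') * (L * c * a' + M * (c * b' + d * a') + N * d * b') -
      (E * c * a' + F * (c * b' + d * a') + G * d * b') * (L * a * a' + M * (a * b' + b * a') + N * b * b')"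
      by algebra
    also have "\<dots> = x * (x * m + y * l') - y * (x * l + y * m)"
      unfolding Ix Iy unfolding a'_def b'_def l_def l'_def m_def by algebra
    also have "\<dots> = m * (x\<^sup>2 - y\<^sup>2) - 2 * l * x * y" unfolding l' by algebra
    finally have "(E * a' + F * b') * (M * a' + N * b') - (F * a' + G * b') * (L * a' + M * b') = 0"
      using eq det k by simp
    from bis[OF nz this] show ?thesis unfolding Ix len by simp
  qed
  have m: "m \<noteq> 0" using key[of 1 0] by auto
  have l: "l = 0"
  proof -
    \<comment> \<open>The eigenvalues are \<open>r\<close> and \<open>- r\<close>, and
      \<open>(l + r, m)\<close> is an eigenvector for \<open>r\<close>; applying \<open>key\<close>
      to it forces \<open>l = 0\<close>.\<close>
    define r where "r = sqrt (l\<^sup>2 + m\<^sup>2)"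
    have r: "r\<^sup>2 = l\<^sup>2 + m\<^sup>2" by (simp add: r_def)
    have e: "m * ((l + r)\<^sup>2 - m\<^sup>2) - 2 * l * (l + r) * m = 0" using r by algebra
    have "(l + r)\<^sup>2 = m\<^sup>2" by (rule key[OF _ e]) (use m in auto)
    with e m have "l * (l + r) = 0" by simp
    moreover have "l + r \<noteq> 0" using \<open>(l + r)\<^sup>2 = m\<^sup>2\<close> m by auto
    ultimately show ?thesis by simp
  qed
  show "L * a\<^sup>2 + 2 * M * a * b + N * b\<^sup>2 = 0" "L * c\<^sup>2 + 2 * M * c * d + N * d\<^sup>2 = 0"
    "L * a * c + M * (a * d + b * c) + N * b * d \<noteq> 0"
    using l l' m unfolding l_def l'_def m_def by simp_all
  have "(a * d - b * c)\<^sup>2 * (L * N - M\<^sup>2) = l * l' - m\<^sup>2"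
    unfolding l_def l'_def m_def by algebra
  then have "k\<^sup>2 * (L * N - M\<^sup>2) = - m\<^sup>2" using det l by simp
  then show "L * N - M\<^sup>2 = - (L * a * c + M * (a * d + b * c) + N * b * d)\<^sup>2 * (E * G - F\<^sup>2)"
    using k(2) unfolding m_def[symmetric] by algebra
qed

section \<open>From the circle hypothesis to a geodesic asymptotic frame\<close>

lemma orthonormal4_eqI:
  fixes x y :: "real^4"
  assumes on: "u1 \<bullet> u1 = 1" "u2 \<bullet> u2 = 1" "u3 \<bullet> u3 = 1" "u4 \<bullet> u4 = 1"
    "u1 \<bullet> u2 = 0" "u1 \<bullet> u3 = 0" "u1 \<bullet> u4 = 0" "u2 \<bullet> u3 = 0" "u2 \<bullet> u4 = 0" "u3 \<bullet> u4 = 0"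
    and eq: "x \<bullet> u1 = y \<bullet> u1" "x \<bullet> u2 = y \<bullet> u2" "x \<bullet> u3 = y \<bullet> u3" "x \<bullet> u4 = y \<bullet> u4"
  shows "x = y"
proof -
  let ?B = "{u1, u2, u3, u4}"
  have ne: "u1 \<noteq> u2" "u1 \<noteq> u3" "u1 \<noteq> u4" "u2 \<noteq> u3" "u2 \<noteq> u4" "u3 \<noteq> u4"
    using on by auto
  have "pairwise orthogonal ?B"
    unfolding pairwise_def orthogonal_def using on by (auto simp: inner_commute)
  moreover have "0 \<notin> ?B" using on by auto
  ultimately have "independent ?B" by (rule pairwise_orthogonal_independent)
  moreover have "card ?B = DIM(real^4)" using ne by simp
  ultimately have "span ?B = UNIV"
    by (metis card_ge_dim_independent dim_UNIV order_refl subset_UNIV top.extremum_uniqueI)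
  then have "x - y \<in> span ?B" by simp
  then have "orthogonal (x - y) (x - y)"
    by (rule orthogonal_to_span) (use eq in \<open>auto simp: orthogonal_def inner_diff_left\<close>)
  then show ?thesis by (simp add: orthogonal_def)
qed

text \<open>Differentiating the coefficients of \<open>W\<close> produces only tangent vectors,
  which \<open>n p\<close> annihilates.\<close>

lemma second_fundamental_form:
  assumes U: "open U" "p \<in> U" and W: "surf_smooth_on U W" and f: "surf_smooth_on U f"
    and n: "unit_normal U f n"
  shows "dirD V (dirD W f) p \<bullet> n p = fst (V p) * fst (W p) * sL f n p
    + (fst (V p) * snd (W p) + snd (V p) * fst (W p)) * sM f n p + snd (V p) * snd (W p) * sN f n p"
proof -
  have "pdu f p \<bullet> n p = 0" "pdv f p \<bullet> n p = 0"
    using n U by (auto simp: unit_normal_def inner_commute)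
  then show ?thesis
    unfolding dirD_dirD[OF U W f]
    by (simp add: dirD_def mixed_partials[OF U f, symmetric] inner_add_left sL_def sM_def sN_def algebra_simps)
qed

lemma dirD_along_curve:
  assumes "g differentiable at (c t)" "(c has_vector_derivative X (c t)) (at t)"
  shows "((\<lambda>t. g (c t)) has_vector_derivative dirD X g (c t)) (at t)"
proof -
  have "((\<lambda>t. g (c t)) has_derivative (\<lambda>s. fst (s *\<^sub>R X (c t)) *\<^sub>R pdu g (c t) + snd (s *\<^sub>R X (c t)) *\<^sub>R pdv g (c t))) (at t)"
    using has_derivative_compose[OF assms(2)[unfolded has_vector_derivative_def] has_derivative_pd[OF assms(1)]] .
  then show ?thesis
    by (simp add: has_vector_derivative_def dirD_def scaleR_right_distrib mult.commute)
qed

text \<open>The hypothesis speaks of integral curves only, so one through \<open>p\<close> must be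
  produced first. Uniqueness of derivatives then identifies \<open>g1\<close>, \<open>g2\<close>,
  \<open>g3\<close> with the iterated derivatives of \<open>f\<close> along
  \<open>X\<close>.\<close>

lemma dirD_third_of_circle:
  fixes f :: "real \<times> real \<Rightarrow> real^4"
  assumes U: "open U" "p \<in> U" and X: "surf_smooth_on U X" and f: "surf_smooth_on U f"
    and circ: "\<And>a b c. a < b \<Longrightarrow> (\<And>t. t \<in> {a<..<b} \<Longrightarrow> c t \<in> U \<and> (c has_vector_derivative X (c t)) (at t)) \<Longrightarrow>
           is_circle {a<..<b} (f \<circ> c)"
  shows "\<exists>k. dirD X (dirD X (dirD X f)) p = k *\<^sub>R dirD X f p"
proof -
  obtain e c where e: "e > 0" and c: "c 0 = p"
    and ct: "\<And>t. t \<in> {-e<..<e} \<Longrightarrow> c t \<in> U \<and> (c has_vector_derivative X (c t)) (at t)"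
    using integral_curve_exists[OF U X] by blast
  let ?I = "{-e<..<e}"
  have "is_circle ?I (f \<circ> c)" by (rule circ) (use e ct in auto)
  then obtain k g1 g2 g3 where g: "\<And>t. t \<in> ?I \<Longrightarrow> (f \<circ> c has_vector_derivative g1 t) (at t)"
      "\<And>t. t \<in> ?I \<Longrightarrow> (g1 has_vector_derivative g2 t) (at t)"
      "\<And>t. t \<in> ?I \<Longrightarrow> (g2 has_vector_derivative g3 t) (at t)"
      "\<And>t. t \<in> ?I \<Longrightarrow> g3 t = - (k\<^sup>2 *\<^sub>R g1 t)"
    unfolding is_circle_def by blast
  have step: "h' t = dirD X g (c t)"
    if g: "surf_smooth_on U g" and h: "\<And>t. t \<in> ?I \<Longrightarrow> h t = g (c t)"
      and h': "\<And>t. t \<in> ?I \<Longrightarrow> (h has_vector_derivative h' t) (at t)" and t: "t \<in> ?I"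
    for g :: "real \<times> real \<Rightarrow> real^4" and h h' t
  proof -
    have "((\<lambda>t. g (c t)) has_vector_derivative dirD X g (c t)) (at t)"
      by (rule dirD_along_curve) (use ct t surf_smooth_on_differentiable[OF g] in auto)
    moreover have "((\<lambda>t. g (c t)) has_vector_derivative h' t) (at t)"
      by (rule has_vector_derivative_transform_within_open[OF h'[OF t], of ?I]) (use h t in auto)
    ultimately show ?thesis by (metis vector_derivative_at)
  qed
  note sm = surf_smooth_on_dirD[OF U(1) X]
  have g1: "g1 t = dirD X f (c t)" if "t \<in> ?I" for t
    by (rule step[OF f _ g(1) that]) simp
  have g2: "g2 t = dirD X (dirD X f) (c t)" if "t \<in> ?I" for t
    by (rule step[OF sm[OF f] g1 g(2) that])
  have g3: "g3 t = dirD X (dirD X (dirD X f)) (c t)" if "t \<in> ?I" for t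
    by (rule step[OF sm[OF sm[OF f]] g2 g(3) that])
  have "0 \<in> ?I" using e by simp
  from g3[OF this] g(4)[OF this] g1[OF this] show ?thesis
    by (intro exI[of _ "- k\<^sup>2"]) (simp add: c)
qed

text \<open>The outcome of the circle hypothesis: integral curves of \<open>X\<close> are great
  circles, those of \<open>Y\<close> are asymptotic, and the mixed entry of the second fundamental
  form never vanishes.\<close>

locale geodesic_asymptotic_frame =
  fixes U :: "(real \<times> real) set" and f n :: "real \<times> real \<Rightarrow> real^4" and X Y :: "real \<times> real \<Rightarrow> real \<times> real"
  assumes open_U: "open U" and connected_U: "connected U"
    and smooth_f: "surf_smooth_on U f" and smooth_X: "surf_smooth_on U X" and smooth_Y: "surf_smooth_on U Y"
    and unit_f: "\<And>p. p \<in> U \<Longrightarrow> f p \<bullet> f p = 1"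
    and normal: "unit_normal U f n"
    and orthonormal: "\<And>p. p \<in> U \<Longrightarrow> dirD X f p \<bullet> dirD X f p = 1"
      "\<And>p. p \<in> U \<Longrightarrow> dirD X f p \<bullet> dirD Y f p = 0" "\<And>p. p \<in> U \<Longrightarrow> dirD Y f p \<bullet> dirD Y f p = 1"
    and independent: "\<And>p. p \<in> U \<Longrightarrow> fst (X p) * snd (Y p) - snd (X p) * fst (Y p) \<noteq> 0"
    and geodesic: "\<And>p. p \<in> U \<Longrightarrow> dirD X (dirD X f) p = - f p"
    and asymptotic: "\<And>p. p \<in> U \<Longrightarrow> dirD Y (dirD Y f) p \<bullet> n p = 0"
    and nonumbilic: "\<And>p. p \<in> U \<Longrightarrow> dirD X (dirD Y f) p \<bullet> n p \<noteq> 0"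

lemma inner_dirD_swap:
  assumes U: "open U" "p \<in> U" and g: "surf_smooth_on U g" and h: "surf_smooth_on U h"
    and const: "\<And>q. q \<in> U \<Longrightarrow> g q \<bullet> h q = c"
  shows "dirD V g p \<bullet> h p = - (g p \<bullet> dirD V h p)"
proof -
  have "dirD V (\<lambda>q. g q \<bullet> h q) p = dirD V (\<lambda>q. c) p"
    by (rule dirD_cong[OF U const])
  then show ?thesis
    using dirD_inner[of g p h V] surf_smooth_on_differentiable[OF g U(2)] surf_smooth_on_differentiable[OF h U(2)]
    by (simp add: dirD_const)
qed

lemma gen_torus_frame:
  assumes T: "gen_torus_first_type U f n"
  shows "\<exists>X Y. geodesic_asymptotic_frame U f n X Y \<and>
    (\<forall>p\<in>U. gauss_curv f n p = 1 - (dirD X (dirD Y f) p \<bullet> n p)\<^sup>2)"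
proof -
  from T have S: "surface_in_S3 U f" and n: "unit_normal U f n" and min: "minimal_in_S3 U f n"
    unfolding gen_torus_first_type_def by auto
  from T obtain X where X: "surf_smooth_on U X"
    and bis: "\<And>p. p \<in> U \<Longrightarrow> bisector_dir f n p (X p)" "\<And>p. p \<in> U \<Longrightarrow> norm (tangent f p (X p)) = 1"
    and circ: "\<And>a b c. a < b \<Longrightarrow> (\<And>t. t \<in> {a<..<b} \<Longrightarrow> c t \<in> U \<and> (c has_vector_derivative X (c t)) (at t)) \<Longrightarrow>
           is_circle {a<..<b} (f \<circ> c)"
    unfolding gen_torus_first_type_def by blast
  have U: "open U" and conn: "connected U" and f: "surf_smooth_on U f"
    and nf: "\<And>p. p \<in> U \<Longrightarrow> f p \<bullet> f p = 1"
    and Delta: "\<And>p. p \<in> U \<Longrightarrow> fE f p * fG f p - (fF f p)\<^sup>2 > 0"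
    using S by (auto simp: surface_in_S3_def norm_eq_1)
  \<comment> \<open>\<open>Y\<close> is \<open>X\<close> turned by a right angle in the tangent
    plane, and \<open>k\<close> is the reciprocal of the area density. Real powers and products are
    used because smoothness is established for exactly these operations.\<close>
  define k where "k p = (fE f p * fG f p - fF f p * fF f p) powr (-1/2)" for p
  define Y where "Y p = (- (fF f p * fst (X p) + fG f p * snd (X p)) * k p,
    (fE f p * fst (X p) + fF f p * snd (X p)) * k p)" for p
  note fst_X = surf_smooth_on_fst[OF U X] and snd_X = surf_smooth_on_snd[OF U X]
  have EFG: "surf_smooth_on U (fE f)" "surf_smooth_on U (fF f)" "surf_smooth_on U (fG f)"
    unfolding fE_def[abs_def] fF_def[abs_def] fG_def[abs_def]
    by (intro surf_smooth_on_inner[OF U] surf_smooth_on_pd[OF f])+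
  have sk: "surf_smooth_on U k"
    unfolding k_def[abs_def]
    by (intro surf_smooth_on_powr[OF U] surf_smooth_on_diff[OF U] surf_smooth_on_mult[OF U] EFG)
      (use Delta in \<open>simp add: power2_eq_square\<close>)
  have Y: "surf_smooth_on U Y"
    unfolding Y_def[abs_def]
    by (intro surf_smooth_on_Pair[OF U] surf_smooth_on_mult[OF U] surf_smooth_on_minus[OF U]
        surf_smooth_on_add[OF U] EFG sk fst_X snd_X)
  have k: "k p > 0" "(k p)\<^sup>2 * (fE f p * fG f p - (fF f p)\<^sup>2) = 1" if p: "p \<in> U" for p
  proof -
    let ?D = "fE f p * fG f p - (fF f p)\<^sup>2"
    have "k p = ?D powr (-1/2)" by (simp add: k_def power2_eq_square)
    moreover have "(?D powr (-1/2))\<^sup>2 = ?D powr (-1)"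
      by (simp add: power2_eq_square powr_add[symmetric])
    ultimately show "k p > 0" "(k p)\<^sup>2 * ?D = 1"
      using Delta[OF p] by (simp_all add: powr_minus_divide)
  qed
  have tan: "tangent f p w \<bullet> tangent f p w' = fE f p * fst w * fst w' + fF f p * (fst w * snd w' + snd w * fst w')
      + fG f p * snd w * snd w'" for p w w'
    by (simp add: tangent_def fE_def fF_def fG_def inner_add_left inner_add_right inner_commute algebra_simps)
  have dirD_tan: "dirD V f p = tangent f p (V p)" for V p
    by (simp add: dirD_def tangent_def)
  have alg: "sL f n p * (fst (X p))\<^sup>2 + 2 * sM f n p * fst (X p) * snd (X p) + sN f n p * (snd (X p))\<^sup>2 = 0"
      "sL f n p * (fst (Y p))\<^sup>2 + 2 * sM f n p * fst (Y p) * snd (Y p) + sN f n p * (snd (Y p))\<^sup>2 = 0"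
      "sL f n p * fst (X p) * fst (Y p) + sM f n p * (fst (X p) * snd (Y p) + snd (X p) * fst (Y p))
        + sN f n p * snd (X p) * snd (Y p) \<noteq> 0"
      "fE f p * fst (X p) * fst (Y p) + fF f p * (fst (X p) * snd (Y p) + snd (X p) * fst (Y p))
        + fG f p * snd (X p) * snd (Y p) = 0"
      "fE f p * (fst (Y p))\<^sup>2 + 2 * fF f p * fst (Y p) * snd (Y p) + fG f p * (snd (Y p))\<^sup>2 = 1"
      "fst (X p) * snd (Y p) - snd (X p) * fst (Y p) = k p"
      "sL f n p * sN f n p - (sM f n p)\<^sup>2 = - (sL f n p * fst (X p) * fst (Y p)
        + sM f n p * (fst (X p) * snd (Y p) + snd (X p) * fst (Y p)) + sN f n p * snd (X p) * snd (Y p))\<^sup>2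
        * (fE f p * fG f p - (fF f p)\<^sup>2)"
      (is ?c7)
    and unit: "fE f p * (fst (X p))\<^sup>2 + 2 * fF f p * fst (X p) * snd (X p) + fG f p * (snd (X p))\<^sup>2 = 1"
    if p: "p \<in> U" for p
  proof -
    have "tangent f p (X p) \<bullet> tangent f p (X p) = 1"
      using bis(2)[OF p] by (simp add: norm_eq_1)
    then show unit: "fE f p * (fst (X p))\<^sup>2 + 2 * fF f p * fst (X p) * snd (X p) + fG f p * (snd (X p))\<^sup>2 = 1"
      unfolding tan by (simp add: algebra_simps power2_eq_square)
    \<comment> \<open>Squaring the angle condition removes the absolute value and the norms; the
      factor 2 is the reciprocal of the squared cosine.\<close>
    have bisp: "2 * (fE f p * fst (X p) * a' + fF f p * (fst (X p) * b' + snd (X p) * a') + fG f p * snd (X p) * b')\<^sup>2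
        = fE f p * a'\<^sup>2 + 2 * fF f p * a' * b' + fG f p * b'\<^sup>2"
      if "(a', b') \<noteq> (0, 0)" and "(fE f p * a' + fF f p * b') * (sM f n p * a' + sN f n p * b')
        - (fF f p * a' + fG f p * b') * (sL f n p * a' + sM f n p * b') = 0" for a' b'
    proof -
      have "principal_dir f n p (a', b')"
        using that by (simp add: principal_dir_def Let_def zero_prod_def)
      then have "\<bar>tangent f p (X p) \<bullet> tangent f p (a', b')\<bar> =
          norm (tangent f p (X p)) * norm (tangent f p (a', b')) * cos (pi / 4)"
        using bis(1)[OF p] by (simp add: bisector_dir_def)
      also have "\<dots> = norm (tangent f p (a', b')) * (sqrt 2 / 2)"
        using bis(2)[OF p] by (simp add: cos_45)
      finally have "\<bar>tangent f p (X p) \<bullet> tangent f p (a', b')\<bar>\<^sup>2 = (norm (tangent f p (a', b')) * (sqrt 2 / 2))\<^sup>2"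
        by (simp only:)
      also have "\<dots> = (tangent f p (a', b') \<bullet> tangent f p (a', b')) / 2"
        by (simp add: power_mult_distrib power_divide power2_norm_eq_inner)
      finally show ?thesis unfolding tan power2_abs by (simp add: algebra_simps power2_eq_square)
    qed
    have minp: "fE f p * sN f n p - 2 * fF f p * sM f n p + fG f p * sL f n p = 0"
      using min p by (simp add: minimal_in_S3_def)
    note * = asymptotic_bisectrix[OF Delta[OF p] minp unit k[OF p], of "fst (Y p)" "snd (Y p)", OF _ _ bisp]
    show "sL f n p * (fst (X p))\<^sup>2 + 2 * sM f n p * fst (X p) * snd (X p) + sN f n p * (snd (X p))\<^sup>2 = 0"
      by (rule *(1)) (simp_all add: Y_def)
    show "sL f n p * (fst (Y p))\<^sup>2 + 2 * sM f n p * fst (Y p) * snd (Y p) + sN f n p * (snd (Y p))\<^sup>2 = 0"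
      by (rule *(2)) (simp_all add: Y_def)
    show "sL f n p * fst (X p) * fst (Y p) + sM f n p * (fst (X p) * snd (Y p) + snd (X p) * fst (Y p))
        + sN f n p * snd (X p) * snd (Y p) \<noteq> 0"
      by (rule *(3)) (simp_all add: Y_def)
    show "fE f p * fst (X p) * fst (Y p) + fF f p * (fst (X p) * snd (Y p) + snd (X p) * fst (Y p))
        + fG f p * snd (X p) * snd (Y p) = 0"
      by (rule *(4)) (simp_all add: Y_def)
    show "fE f p * (fst (Y p))\<^sup>2 + 2 * fF f p * fst (Y p) * snd (Y p) + fG f p * (snd (Y p))\<^sup>2 = 1"
      by (rule *(5)) (simp_all add: Y_def)
    show "fst (X p) * snd (Y p) - snd (X p) * fst (Y p) = k p"
      by (rule *(6)) (simp_all add: Y_def)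
    show ?c7
      by (rule *(7)) (simp_all add: Y_def)
  qed
  note II = second_fundamental_form[OF U _ _ f n]
  have II_XX: "dirD X (dirD X f) p \<bullet> n p = 0" if "p \<in> U" for p
    using alg(1)[OF that] unfolding II[OF that X] by (simp add: algebra_simps power2_eq_square)
  have II_YY: "dirD Y (dirD Y f) p \<bullet> n p = 0" if "p \<in> U" for p
    using alg(2)[OF that] unfolding II[OF that Y] by (simp add: algebra_simps power2_eq_square)
  have II_XY_eq: "dirD X (dirD Y f) p \<bullet> n p = sL f n p * fst (X p) * fst (Y p)
      + sM f n p * (fst (X p) * snd (Y p) + snd (X p) * fst (Y p)) + sN f n p * snd (X p) * snd (Y p)"
    if "p \<in> U" for p
    unfolding II[OF that Y] by (simp add: algebra_simps)
  then have II_XY: "dirD X (dirD Y f) p \<bullet> n p \<noteq> 0" if "p \<in> U" for p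
    using alg(3)[OF that] that by simp
  have orth: "dirD X f p \<bullet> dirD X f p = 1" "dirD X f p \<bullet> dirD Y f p = 0" "dirD Y f p \<bullet> dirD Y f p = 1"
    if "p \<in> U" for p
    using unit[OF that] alg(4,5)[OF that] unfolding dirD_tan tan
    by (simp_all add: algebra_simps power2_eq_square)
  have sm: "surf_smooth_on U (dirD X f)" "surf_smooth_on U (dirD Y f)" "surf_smooth_on U (dirD X (dirD X f))"
    by (intro surf_smooth_on_dirD[OF U] X Y f)+
  have f_orth: "dirD V f p \<bullet> f p = 0" if "p \<in> U" for V p
    using inner_dirD_swap[OF U that f f nf] by (simp add: inner_commute)
  have n_perp: "n p \<bullet> n p = 1" "n p \<bullet> f p = 0" "n p \<bullet> dirD V f p = 0" if "p \<in> U" for V p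
    using n that by (auto simp: unit_normal_def norm_eq_1 dirD_def inner_add_right)
  \<comment> \<open>The signed geodesic curvature, within the surface, of the integral curves of
    \<open>X\<close>.\<close>
  define g where "g p = dirD X (dirD X f) p \<bullet> dirD Y f p" for p
  have sg: "surf_smooth_on U g" unfolding g_def[abs_def] by (rule surf_smooth_on_inner[OF U sm(3,2)])
  have XX: "dirD X (dirD X f) p = - f p + g p *\<^sub>R dirD Y f p" if p: "p \<in> U" for p
  proof (rule orthonormal4_eqI[of "f p" "dirD X f p" "dirD Y f p" "n p"])
    have "dirD X (dirD X f) p \<bullet> f p = - (dirD X f p \<bullet> dirD X f p)"
      by (rule inner_dirD_swap[OF U p sm(1) f f_orth])
    then show "dirD X (dirD X f) p \<bullet> f p = (- f p + g p *\<^sub>R dirD Y f p) \<bullet> f p"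
      using orth[OF p] nf[OF p] f_orth[OF p] by (simp add: inner_add_left inner_diff_left inner_diff_right)
    have "dirD X (dirD X f) p \<bullet> dirD X f p = - (dirD X f p \<bullet> dirD X (dirD X f) p)"
      by (rule inner_dirD_swap[OF U p sm(1) sm(1) orth(1)])
    then show "dirD X (dirD X f) p \<bullet> dirD X f p = (- f p + g p *\<^sub>R dirD Y f p) \<bullet> dirD X f p"
      using orth[OF p] f_orth[OF p] by (simp add: inner_add_left inner_diff_left inner_diff_right inner_commute)
  qed (use II_XX[OF p] n_perp[OF p] orth[OF p] f_orth[OF p] nf[OF p] in
      \<open>simp_all add: inner_add_left inner_diff_left inner_diff_right inner_commute g_def\<close>)
  \<comment> \<open>A circle has third derivative parallel to its tangent, while the normal component of the third
    derivative of an asymptotic line is its geodesic curvature times the nonzero torsion term.\<close>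
  have "g p = 0" if p: "p \<in> U" for p
  proof -
    have dif: "f differentiable at p" "g differentiable at p" "dirD Y f differentiable at p"
      using f sg sm(2) p surf_smooth_on_differentiable by blast+
    have "dirD X (dirD X (dirD X f)) p = dirD X (\<lambda>p. - f p + g p *\<^sub>R dirD Y f p) p"
      by (rule dirD_cong[OF U p XX])
    also have "\<dots> = - dirD X f p + (dirD X g p *\<^sub>R dirD Y f p + g p *\<^sub>R dirD X (dirD Y f) p)"
      by (subst dirD_add)
        (use dif in \<open>auto simp: dirD_minus dirD_scaleR intro!: derivative_intros\<close>)
    finally have "dirD X (dirD X (dirD X f)) p \<bullet> n p = g p * (dirD X (dirD Y f) p \<bullet> n p)"
      using n_perp[OF p]
      by (simp add: inner_add_left inner_add_right inner_diff_left inner_diff_right inner_commute)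
    moreover obtain c where "dirD X (dirD X (dirD X f)) p = c *\<^sub>R dirD X f p"
      using dirD_third_of_circle[OF U p X f circ] by blast
    ultimately show ?thesis using n_perp[OF p] II_XY[OF p] by (simp add: inner_commute)
  qed
  then have geo: "dirD X (dirD X f) p = - f p" if "p \<in> U" for p
    using XX that by simp
  have "geodesic_asymptotic_frame U f n X Y"
  proof
    show "fst (X p) * snd (Y p) - snd (X p) * fst (Y p) \<noteq> 0" if "p \<in> U" for p
      using alg(6)[OF that] k(1)[OF that] by simp
  qed (fact U conn f X Y n nf orth geo II_YY II_XY)+
  moreover have "gauss_curv f n p = 1 - (dirD X (dirD Y f) p \<bullet> n p)\<^sup>2" if p: "p \<in> U" for p
    unfolding gauss_curv_def alg(7)[OF p] II_XY_eq[OF p] using Delta[OF p] by simp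
  ultimately show ?thesis by blast
qed

subsection \<open>Structure equations and the Killing field\<close>

text \<open>Here \<open>2 * v\<close> is the componentwise product of \<open>real^4\<close>; the
  rule returns it to a scalar multiple in the computation of
  \<open>\<Omega>_constant\<close>.\<close>

lemma scaleR_double: "r *\<^sub>R (2 * v) = (2 * r) *\<^sub>R v" for v :: "real^4"
  by (simp only: mult_2 scaleR_right_distrib scaleR_left_distrib)

context geodesic_asymptotic_frame
begin

abbreviation "e1 \<equiv> dirD X f"
abbreviation "e2 \<equiv> dirD Y f"
abbreviation "m \<equiv> dirD X e2"
definition "\<omega> p = dirD Y e1 p \<bullet> e2 p"
text \<open>Equal to 1 minus the Gauss curvature, yet smooth whatever signs \<open>n\<close>
  takes.\<close>

definition "\<rho> p = m p \<bullet> m p"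
definition "h p = \<rho> p powr (-1/4)"

lemma smooth_frame:
  "surf_smooth_on U e1" "surf_smooth_on U e2" "surf_smooth_on U m"
  "surf_smooth_on U \<omega>" "surf_smooth_on U \<rho>"
proof -
  show "surf_smooth_on U e1" "surf_smooth_on U e2" "surf_smooth_on U m"
    by (intro surf_smooth_on_dirD open_U smooth_X smooth_Y smooth_f)+
  show "surf_smooth_on U \<omega>" "surf_smooth_on U \<rho>"
    unfolding \<omega>_def[abs_def] \<rho>_def[abs_def]
    by (intro surf_smooth_on_inner surf_smooth_on_dirD open_U smooth_X smooth_Y smooth_f)+
qed

context
  fixes p assumes p: "p \<in> U"
begin

lemmas frame_differentiable =
  surf_smooth_on_differentiable[OF smooth_f p] smooth_frame[THEN surf_smooth_on_differentiable, OF p]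

lemma normal_inner: "n p \<bullet> n p = 1" "n p \<bullet> f p = 0" "n p \<bullet> dirD V f p = 0"
  using normal p by (auto simp: unit_normal_def norm_eq_1 dirD_def inner_add_right)

lemma inner_f_e: "f p \<bullet> dirD V f p = 0"
  using inner_dirD_swap[OF open_U p smooth_f smooth_f unit_f, of V] by (simp add: inner_commute)

end

text \<open>Because \<open>X\<close> is geodesic, \<open>e1\<close> changes only in the direction of
  \<open>f\<close>, so orthonormality leaves a purely normal derivative of \<open>e2\<close>. Thus
  \<open>m\<close> is a smooth normal field.\<close>

lemma m_orthogonal:
  assumes p: "p \<in> U"
  shows "m p \<bullet> f p = 0" "m p \<bullet> e1 p = 0" "m p \<bullet> e2 p = 0"
proof -
  have "e2 q \<bullet> f q = 0" if "q \<in> U" for q using inner_f_e[OF that] by (simp add: inner_commute)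
  from inner_dirD_swap[OF open_U p smooth_frame(2) smooth_f this, of X]
  show "m p \<bullet> f p = 0" using orthonormal[OF p] by (simp add: inner_commute)
  have "e2 q \<bullet> e1 q = 0" if "q \<in> U" for q using orthonormal(2)[OF that] by (simp add: inner_commute)
  from inner_dirD_swap[OF open_U p smooth_frame(2,1) this, of X]
  show "m p \<bullet> e1 p = 0" using inner_f_e[OF p, of Y] by (simp add: geodesic p inner_commute)
  show "m p \<bullet> e2 p = 0"
    using inner_dirD_swap[OF open_U p smooth_frame(2,2) orthonormal(3), of X] by (simp add: inner_commute)
qed

lemma frame_eqI:
  assumes p: "p \<in> U"
    and "x \<bullet> f p = y \<bullet> f p" "x \<bullet> e1 p = y \<bullet> e1 p" "x \<bullet> e2 p = y \<bullet> e2 p" "x \<bullet> n p = y \<bullet> n p"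
  shows "x = y"
  by (rule orthonormal4_eqI[of "f p" "e1 p" "e2 p" "n p"])
    (use assms normal_inner[OF p] inner_f_e[OF p] unit_f[OF p] orthonormal[OF p] in \<open>auto simp: inner_commute\<close>)

lemma m_eq: "p \<in> U \<Longrightarrow> m p = (m p \<bullet> n p) *\<^sub>R n p"
  by (rule frame_eqI) (auto simp: m_orthogonal normal_inner)

lemma \<rho>_eq: "p \<in> U \<Longrightarrow> \<rho> p = (m p \<bullet> n p)\<^sup>2"
  unfolding \<rho>_def by (subst (1) m_eq) (auto simp: power2_eq_square inner_commute)

lemma \<rho>_pos: "p \<in> U \<Longrightarrow> \<rho> p > 0"
  using nonumbilic[of p] by (simp add: \<rho>_eq)

lemma dirD_Y_e1:
  assumes p: "p \<in> U"
  shows "dirD Y e1 p = \<omega> p *\<^sub>R e2 p + m p"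
proof (rule frame_eqI[OF p])
  have "e1 q \<bullet> f q = 0" if "q \<in> U" for q using inner_f_e[OF that] by (simp add: inner_commute)
  from inner_dirD_swap[OF open_U p smooth_frame(1) smooth_f this, of Y]
  show "dirD Y e1 p \<bullet> f p = (\<omega> p *\<^sub>R e2 p + m p) \<bullet> f p"
    using orthonormal[OF p] m_orthogonal[OF p] inner_f_e[OF p] by (simp add: inner_add_left inner_add_right inner_commute)
  show "dirD Y e1 p \<bullet> e1 p = (\<omega> p *\<^sub>R e2 p + m p) \<bullet> e1 p"
    using inner_dirD_swap[OF open_U p smooth_frame(1,1) orthonormal(1), of Y] orthonormal[OF p] m_orthogonal[OF p]
    by (simp add: inner_add_left inner_add_right inner_commute)
  show "dirD Y e1 p \<bullet> e2 p = (\<omega> p *\<^sub>R e2 p + m p) \<bullet> e2 p"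
    using orthonormal[OF p] m_orthogonal[OF p] by (simp add: inner_add_left \<omega>_def)
  \<comment> \<open>The bracket of \<open>X\<close> and \<open>Y\<close> applied to \<open>f\<close>
    is tangent: this is the symmetry of the second fundamental form.\<close>
  have "(m p - dirD Y e1 p) \<bullet> n p = 0"
    using dirD_commutator[OF open_U p smooth_X smooth_Y smooth_f] normal_inner[OF p] by (simp add: inner_commute)
  then show "dirD Y e1 p \<bullet> n p = (\<omega> p *\<^sub>R e2 p + m p) \<bullet> n p"
    using normal_inner[OF p] by (simp add: inner_add_left inner_diff_left inner_add_right inner_diff_right inner_commute)
qed

lemma dirD_Y_e2:
  assumes p: "p \<in> U"
  shows "dirD Y e2 p = - (\<omega> p *\<^sub>R e1 p) - f p"
proof (rule frame_eqI[OF p])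
  have "e2 q \<bullet> f q = 0" if "q \<in> U" for q using inner_f_e[OF that] by (simp add: inner_commute)
  from inner_dirD_swap[OF open_U p smooth_frame(2) smooth_f this, of Y]
  show "dirD Y e2 p \<bullet> f p = (- (\<omega> p *\<^sub>R e1 p) - f p) \<bullet> f p"
    using orthonormal[OF p] inner_f_e[OF p] unit_f[OF p] by (simp add: inner_diff_left inner_diff_right inner_commute)
  have "e2 q \<bullet> e1 q = 0" if "q \<in> U" for q using orthonormal(2)[OF that] by (simp add: inner_commute)
  from inner_dirD_swap[OF open_U p smooth_frame(2,1) this, of Y]
  show "dirD Y e2 p \<bullet> e1 p = (- (\<omega> p *\<^sub>R e1 p) - f p) \<bullet> e1 p"
    using orthonormal[OF p] inner_f_e[OF p] by (simp add: inner_diff_left inner_diff_right inner_commute \<omega>_def)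
  show "dirD Y e2 p \<bullet> e2 p = (- (\<omega> p *\<^sub>R e1 p) - f p) \<bullet> e2 p"
    using inner_dirD_swap[OF open_U p smooth_frame(2,2) orthonormal(3), of Y] orthonormal[OF p] inner_f_e[OF p]
    by (simp add: inner_diff_left inner_diff_right inner_commute)
  show "dirD Y e2 p \<bullet> n p = (- (\<omega> p *\<^sub>R e1 p) - f p) \<bullet> n p"
    using asymptotic[OF p] normal_inner[OF p] by (simp add: inner_diff_left inner_diff_right inner_commute)
qed

section \<open>Bracket of the frame and compatibility equations\<close>

lemma commutator_XY:
  fixes g :: "real \<times> real \<Rightarrow> 'a::euclidean_space"
  assumes p: "p \<in> U" and g: "surf_smooth_on U g"
  shows "dirD X (dirD Y g) p = dirD Y (dirD X g) p - \<omega> p *\<^sub>R dirD Y g p"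
proof -
  define Z where "Z q = dirD X Y q - dirD Y X q" for q
  let ?D = "fst (X p) * snd (Y p) - snd (X p) * fst (Y p)"
  define x where "x = (fst (Z p) * snd (Y p) - snd (Z p) * fst (Y p)) / ?D"
  define y where "y = (fst (X p) * snd (Z p) - snd (X p) * fst (Z p)) / ?D"
  have "x * ?D = fst (Z p) * snd (Y p) - snd (Z p) * fst (Y p)"
    "y * ?D = fst (X p) * snd (Z p) - snd (X p) * fst (Z p)"
    using independent[OF p] unfolding x_def y_def by simp_all
  then have "?D * (x * fst (X p) + y * fst (Y p)) = ?D * fst (Z p)"
    "?D * (x * snd (X p) + y * snd (Y p)) = ?D * snd (Z p)"
    by algebra+
  then have Z: "fst (Z p) = x * fst (X p) + y * fst (Y p)" "snd (Z p) = x * snd (X p) + y * snd (Y p)"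
    using independent[OF p] by simp_all
  have dirZ: "dirD Z g p = x *\<^sub>R dirD X g p + y *\<^sub>R dirD Y g p"
    for g :: "real \<times> real \<Rightarrow> 'b::real_normed_vector"
    by (simp add: dirD_def Z algebra_simps)
  \<comment> \<open>The coefficients of the bracket are read off from its action on the immersion
    \<open>f\<close>, and they then hold for every \<open>g\<close>.\<close>
  have "x *\<^sub>R e1 p + y *\<^sub>R e2 p = - (\<omega> p *\<^sub>R e2 p)"
    using dirD_commutator[OF open_U p smooth_X smooth_Y smooth_f] dirD_Y_e1[OF p]
    unfolding Z_def[abs_def, symmetric] dirZ by simp
  then have "(x *\<^sub>R e1 p + y *\<^sub>R e2 p) \<bullet> e1 p = - (\<omega> p *\<^sub>R e2 p) \<bullet> e1 p"
    "(x *\<^sub>R e1 p + y *\<^sub>R e2 p) \<bullet> e2 p = - (\<omega> p *\<^sub>R e2 p) \<bullet> e2 p" by simp_all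
  then have "x = 0" "y = - \<omega> p"
    using orthonormal[OF p] by (simp_all add: inner_add_left inner_add_right inner_commute)
  then show ?thesis
    using dirD_commutator[OF open_U p smooth_X smooth_Y g]
    unfolding Z_def[abs_def, symmetric] dirZ by (simp add: algebra_simps)
qed

text \<open>The bracket applied to \<open>e1\<close>, whose derivative along \<open>X\<close> is
  \<open>- f\<close>. The still unknown derivative of \<omega> is found next from the component
  along \<open>e2\<close>.\<close>

lemma dirD_X_m_aux:
  assumes p: "p \<in> U"
  shows "dirD X m p = - ((dirD X \<omega> p + 1 + (\<omega> p)\<^sup>2) *\<^sub>R e2 p) - (2 * \<omega> p) *\<^sub>R m p"
proof -
  note d = frame_differentiable[OF p]
  have "dirD X (dirD Y e1) p = dirD X (\<lambda>p. \<omega> p *\<^sub>R e2 p + m p) p"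
    by (rule dirD_cong[OF open_U p dirD_Y_e1])
  also have "\<dots> = dirD X \<omega> p *\<^sub>R e2 p + \<omega> p *\<^sub>R m p + dirD X m p"
    by (subst dirD_add) (auto simp: dirD_scaleR d intro!: derivative_intros)
  moreover have "dirD Y (dirD X e1) p = dirD Y (\<lambda>p. - f p) p"
    by (rule dirD_cong[OF open_U p geodesic])
  then have "dirD Y (dirD X e1) p = - e2 p" using d by (simp add: dirD_minus)
  moreover have "(2 * \<omega> p) *\<^sub>R m p = \<omega> p *\<^sub>R (m p + m p)"
    by (simp only: scaleR_right_distrib scaleR_left_distrib mult_2)
  ultimately show ?thesis
    using commutator_XY[OF p smooth_frame(1)] dirD_Y_e1[OF p]
    by (simp add: algebra_simps power2_eq_square)
qed

text \<open>The Gauss equation in Riccati form. Since \<open>m\<close> stays orthogonal to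
  \<open>e2\<close>, the component of its derivative along \<open>e2\<close> is known independently,
  and comparison gives the equation.\<close>

lemma dirD_X_\<omega>:
  assumes p: "p \<in> U"
  shows "dirD X \<omega> p = \<rho> p - 1 - (\<omega> p)\<^sup>2"
proof -
  have "dirD X m p \<bullet> e2 p = - \<rho> p"
    using inner_dirD_swap[OF open_U p smooth_frame(3,2) m_orthogonal(3)] by (simp add: \<rho>_def)
  then show ?thesis
    unfolding dirD_X_m_aux[OF p] using orthonormal[OF p] m_orthogonal[OF p]
    by (simp add: inner_diff_left)
qed

lemma dirD_X_m: "p \<in> U \<Longrightarrow> dirD X m p = - (\<rho> p *\<^sub>R e2 p) - (2 * \<omega> p) *\<^sub>R m p"
  using dirD_X_m_aux dirD_X_\<omega> by simp

text \<open>The bracket applied to \<open>e2\<close>; the Riccati equation collapses the coefficient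
  of \<open>e1\<close> to \<open>- \<rho>\<close>.\<close>

lemma dirD_Y_m:
  assumes p: "p \<in> U"
  shows "dirD Y m p = - (\<rho> p *\<^sub>R e1 p)"
proof -
  note d = frame_differentiable[OF p]
  have "dirD X (dirD Y e2) p = dirD X (\<lambda>p. - (\<omega> p *\<^sub>R e1 p) - f p) p"
    by (rule dirD_cong[OF open_U p dirD_Y_e2])
  also have "\<dots> = - (dirD X \<omega> p *\<^sub>R e1 p) + \<omega> p *\<^sub>R f p - e1 p"
    by (subst dirD_diff) (auto simp: dirD_minus dirD_scaleR d geodesic p intro!: derivative_intros)
  finally show ?thesis
    using commutator_XY[OF p smooth_frame(2)] dirD_Y_e2[OF p] dirD_X_\<omega>[OF p]
    by (simp add: algebra_simps power2_eq_square eq_neg_iff_add_eq_0)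
qed

lemma dirD_X_\<rho>: "p \<in> U \<Longrightarrow> dirD X \<rho> p = - 4 * \<omega> p * \<rho> p"
  using m_orthogonal[of p] unfolding \<rho>_def[abs_def]
  by (simp add: dirD_inner frame_differentiable dirD_X_m m_orthogonal inner_diff_left inner_diff_right inner_commute)

lemma dirD_Y_\<rho>: "p \<in> U \<Longrightarrow> dirD Y \<rho> p = 0"
  using m_orthogonal[of p] unfolding \<rho>_def[abs_def]
  by (simp add: dirD_inner frame_differentiable dirD_Y_m m_orthogonal inner_commute)

text \<open>The bracket applied to \<rho>, which is constant along \<open>Y\<close>: only the
  derivative of the factor \<omega> in \<open>dirD X \<rho>\<close> survives, and \<rho> is
  positive.\<close>

lemma dirD_Y_\<omega>:
  assumes p: "p \<in> U"
  shows "dirD Y \<omega> p = 0"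
proof -
  have "dirD X (dirD Y \<rho>) p = dirD X (\<lambda>p. 0) p"
    by (rule dirD_cong[OF open_U p dirD_Y_\<rho>])
  moreover have "dirD Y (dirD X \<rho>) p = dirD Y (\<lambda>p. (- 4 * \<omega> p) * \<rho> p) p"
    by (rule dirD_cong[OF open_U p dirD_X_\<rho>])
  moreover have "\<dots> = - 4 * dirD Y \<omega> p * \<rho> p"
    using frame_differentiable[OF p] dirD_Y_\<rho>[OF p]
    by (subst dirD_mult) (auto simp: dirD_mult dirD_minus dirD_const intro!: derivative_intros)
  ultimately show ?thesis
    using commutator_XY[OF p smooth_frame(5)] dirD_Y_\<rho>[OF p] \<rho>_pos[OF p] by (simp add: dirD_const)
qed

section \<open>The infinitesimal rotation of the surface\<close>

lemma h_pos: "p \<in> U \<Longrightarrow> h p > 0"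
  using \<rho>_pos[of p] by (simp add: h_def)

lemma smooth_h: "surf_smooth_on U h"
  unfolding h_def[abs_def] by (rule surf_smooth_on_powr[OF open_U smooth_frame(5) \<rho>_pos])

lemma dirD_h:
  assumes p: "p \<in> U"
  shows "dirD X h p = \<omega> p * h p" "dirD Y h p = 0"
proof -
  have "\<rho> p powr (-1/4) = \<rho> p powr (-1/4 - 1) * \<rho> p"
    using \<rho>_pos[OF p] powr_mult_base[of "\<rho> p" "-1/4 - 1"] by (simp add: mult.commute)
  then show "dirD X h p = \<omega> p * h p" "dirD Y h p = 0"
    unfolding h_def[abs_def]
    using frame_differentiable[OF p] \<rho>_pos[OF p] dirD_X_\<rho>[OF p] dirD_Y_\<rho>[OF p]
    by (simp_all add: dirD_powr)
qed

text \<open>The sum of bivectors \<open>h\<close> times (f wedge e2 + \<omega> e1 wedge e2 + e1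
  wedge m), read as a skew map. The coefficients are chosen so that it acts on \<open>f\<close>,
  \<open>e1\<close>, \<open>e2\<close> and \<open>m\<close> as \<open>h\<close> times the derivative
  along \<open>Y\<close>.\<close>

definition "\<Omega> p v = h p *\<^sub>R ((f p \<bullet> v) *\<^sub>R e2 p - (e2 p \<bullet> v) *\<^sub>R f p
    + \<omega> p *\<^sub>R ((e1 p \<bullet> v) *\<^sub>R e2 p - (e2 p \<bullet> v) *\<^sub>R e1 p) + (e1 p \<bullet> v) *\<^sub>R m p - (m p \<bullet> v) *\<^sub>R e1 p)"

text \<open>For fixed \<open>v\<close> both frame derivatives cancel. Along \<open>Y\<close>, with
  \<open>h\<close> and \<omega> constant, the change of \<Omega> is proportional to its commutator
  with itself; along \<open>X\<close> the growth of \<open>h\<close> balances the term in \<omega>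
  from the derivative of \<open>m\<close>.\<close>

lemma \<Omega>_constant:
  assumes "p \<in> U" "q \<in> U"
  shows "\<Omega> p v = \<Omega> q v"
proof (rule constant_if_dirD_zero[OF open_U connected_U _ _ _ independent assms])
  fix p assume p: "p \<in> U"
  note d = frame_differentiable[OF p] surf_smooth_on_differentiable[OF smooth_h p]
  have [simp]: "(\<lambda>q. g q \<bullet> v) differentiable at p" if "g differentiable at p" for g :: "real \<times> real \<Rightarrow> real^4"
    using that by (auto simp: differentiable_def intro: has_derivative_inner_left)
  have "surf_smooth_on U (\<lambda>p. \<Omega> p v)"
    unfolding \<Omega>_def
    by (intro surf_smooth_on_add surf_smooth_on_diff surf_smooth_on_scaleR surf_smooth_on_inner
        surf_smooth_on_const smooth_f smooth_frame smooth_h open_U)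
  then show "(\<lambda>p. \<Omega> p v) differentiable at p"
    by (rule surf_smooth_on_differentiable[OF _ p])
  show "dirD X (\<lambda>p. \<Omega> p v) p = 0"
    unfolding \<Omega>_def
    by (simp add: dirD_add dirD_diff dirD_scaleR dirD_inner dirD_const d dirD_h[OF p] dirD_X_m[OF p]
        dirD_X_\<omega>[OF p] geodesic[OF p])
      (simp add: scaleR_double algebra_simps power2_eq_square inner_add_left inner_diff_left)
  show "dirD Y (\<lambda>p. \<Omega> p v) p = 0"
    unfolding \<Omega>_def
    by (simp add: dirD_add dirD_diff dirD_scaleR dirD_inner dirD_const d dirD_h[OF p] dirD_Y_m[OF p]
        dirD_Y_\<omega>[OF p] dirD_Y_e1[OF p] dirD_Y_e2[OF p])
      (simp add: algebra_simps power2_eq_square inner_add_left inner_diff_left)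
qed auto

lemma \<Omega>_skew: "\<Omega> p v \<bullet> w = - (v \<bullet> \<Omega> p w)"
  by (simp add: \<Omega>_def algebra_simps inner_add_left inner_diff_left inner_add_right inner_diff_right inner_commute)

lemma \<Omega>_frame:
  assumes p: "p \<in> U"
  shows "\<Omega> p (f p) = h p *\<^sub>R e2 p" "\<Omega> p (e1 p) = h p *\<^sub>R (\<omega> p *\<^sub>R e2 p + m p)"
    "\<Omega> p (e2 p) = - (h p *\<^sub>R (f p + \<omega> p *\<^sub>R e1 p))" "\<Omega> p (m p) = - ((h p * \<rho> p) *\<^sub>R e1 p)"
  unfolding \<Omega>_def using inner_f_e[OF p] orthonormal[OF p] m_orthogonal[OF p] unit_f[OF p]
  by (simp_all add: inner_commute \<rho>_def algebra_simps)

lemma linear_\<Omega>: "linear (\<Omega> p)"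
  by (rule linearI) (simp_all add: \<Omega>_def algebra_simps)

end

subsection \<open>Normal form and phases\<close>

text \<open>The eigenvalues are the half trace plus and minus \<open>R\<close>, and the eigenbasis
  is a rotation by half the angle of \<open>((a - d) / 2, b)\<close>. A nonscalar matrix has
  \<open>R > 0\<close>, so they differ; positive determinant and \<open>a > 0\<close> make both
  positive.\<close>

lemma symmetric_2x2_diagonalizable:
  fixes a b d :: real
  assumes pos: "a > 0" "a * d - b\<^sup>2 > 0" and nonscalar: "b \<noteq> 0 \<or> a \<noteq> d"
  shows "\<exists>c s l k. c\<^sup>2 + s\<^sup>2 = 1 \<and> l > 0 \<and> k > 0 \<and> l \<noteq> k \<and>
    a * c - b * s = l * c \<and> b * c - d * s = - l * s \<and> a * s + b * c = k * s \<and> b * s + d * c = k * c"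
proof -
  define R where "R = sqrt (((a - d) / 2)\<^sup>2 + b\<^sup>2)"
  have "((a - d) / 2)\<^sup>2 + b\<^sup>2 > 0"
    using nonscalar by (auto simp: add_nonneg_pos add_pos_nonneg)
  then have R: "R > 0" "R\<^sup>2 = ((a - d) / 2)\<^sup>2 + b\<^sup>2" by (simp_all add: R_def)
  have "((a - d) / 2 / R)\<^sup>2 + (b / R)\<^sup>2 = R\<^sup>2 / R\<^sup>2"
    by (simp only: power_divide[of _ R] add_divide_distrib[symmetric] R(2))
  then have "((a - d) / 2 / R)\<^sup>2 + (b / R)\<^sup>2 = 1" using R(1) by simp
  then obtain \<phi> where \<phi>: "(a - d) / 2 / R = cos \<phi>" "b / R = sin \<phi>"
    by (metis sincos_total_2pi)
  define c where "c = cos (\<phi> / 2)"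
  define s where "s = - sin (\<phi> / 2)"
  have cs: "c\<^sup>2 + s\<^sup>2 = 1" by (simp add: c_def s_def)
  have "cos \<phi> = c\<^sup>2 - s\<^sup>2" "sin \<phi> = - 2 * c * s"
    using cos_double[of "\<phi> / 2"] sin_double[of "\<phi> / 2"] by (simp_all add: c_def s_def)
  then have "(a - d) / 2 / R = c\<^sup>2 - s\<^sup>2" "b / R = - 2 * c * s"
    using \<phi> by simp_all
  then have "(a - d) / 2 = R * (c\<^sup>2 - s\<^sup>2)" "b = - 2 * R * c * s"
    using R(1) by (simp_all add: divide_eq_eq mult_ac)
  moreover define \<sigma> where "\<sigma> = (a + d) / 2"
  ultimately have abd: "a = \<sigma> + R * (c\<^sup>2 - s\<^sup>2)" "d = \<sigma> - R * (c\<^sup>2 - s\<^sup>2)" "b = - 2 * R * c * s"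
    by (simp_all add: field_simps)
  have "(\<sigma> + R) * (\<sigma> - R) = a * d - b\<^sup>2"
    using R(2) by (simp add: \<sigma>_def power2_eq_square field_simps)
  then have prod: "(\<sigma> + R) * (\<sigma> - R) > 0" using pos by simp
  have "d > 0" using pos by (smt (verit) mult_nonneg_nonpos zero_le_power2)
  then have "\<sigma> + R > 0" using pos(1) R(1) by (simp add: \<sigma>_def add_pos_pos)
  with prod have "\<sigma> - R > 0" by (simp add: zero_less_mult_iff)
  have "a * c - b * s = (\<sigma> + R) * c" "b * c - d * s = - (\<sigma> + R) * s"
    "a * s + b * c = (\<sigma> - R) * s" "b * s + d * c = (\<sigma> - R) * c"
    using cs unfolding abd by algebra+
  with cs \<open>\<sigma> + R > 0\<close> \<open>\<sigma> - R > 0\<close> R(1) show ?thesis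
    by (intro exI[of _ c] exI[of _ s] exI[of _ "\<sigma> + R"] exI[of _ "\<sigma> - R"]) auto
qed

lemma cis_Im_Ln:
  assumes "norm z = 1"
  shows "cis (Im (Ln z)) = z"
proof -
  have "z \<noteq> 0" using assms by auto
  then have "z = exp (Ln z)" by simp
  also have "\<dots> = cis (Im (Ln z))"
    using assms \<open>z \<noteq> 0\<close> by (simp add: exp_eq_polar)
  finally show ?thesis by simp
qed

text \<open>On a ball where \<open>g\<close> stays within distance 1 of \<open>g p\<close>, the
  quotient \<open>g q / g p\<close> avoids the branch cut of \<open>Ln\<close>. The radius depends
  neither on \<open>q0\<close> nor on \<open>a\<close>, so a lift may start at any point of the
  ball; the connectedness argument relies on this.\<close>

lemma phase_lift:
  fixes g :: "real \<times> real \<Rightarrow> complex"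
  assumes U: "open U" "p \<in> U" and g: "\<And>q. q \<in> U \<Longrightarrow> g differentiable at q"
    and norm_g: "\<And>q. q \<in> U \<Longrightarrow> norm (g q) = 1"
  obtains r where "r > 0" "ball p r \<subseteq> U"
    "\<And>q0 a. q0 \<in> ball p r \<Longrightarrow> cis a = g q0 \<Longrightarrow> \<exists>L. L q0 = a \<and> (\<forall>q\<in>ball p r. cis (L q) = g q \<and>
      L differentiable at q \<and> (\<forall>V. dirD V L q = Im (dirD V g q / g q)))"
proof -
  have "isCont g p" using g[OF U(2)] by (rule differentiable_imp_continuous_within)
  then obtain r1 where r1: "r1 > 0" "\<And>q. dist q p < r1 \<Longrightarrow> dist (g q) (g p) < 1"
    unfolding continuous_at_eps_delta by (metis zero_less_one)
  obtain r2 where r2: "r2 > 0" "ball p r2 \<subseteq> U" using U by (meson openE)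
  define r where "r = min r1 r2"
  have r: "r > 0" "ball p r \<subseteq> U" using r1 r2 by (auto simp: r_def)
  have gp: "norm (g p) = 1" "g p \<noteq> 0" using norm_g[OF U(2)] by auto
  have slit: "g q / g p \<notin> \<real>\<^sub>\<le>\<^sub>0" if q: "q \<in> ball p r" for q
  proof -
    have "g q / g p - 1 = (g q - g p) / g p" using gp by (simp add: diff_divide_distrib)
    then have "norm (g q / g p - 1) = norm (g q - g p) / norm (g p)" by (simp add: norm_divide)
    also have "\<dots> < 1" using r1(2)[of q] q gp by (simp add: r_def dist_norm norm_minus_commute)
    finally have "Re (g q / g p) > 0"
      using abs_Re_le_cmod[of "g q / g p - 1"] by simp
    then show ?thesis by (auto simp: complex_nonpos_Reals_iff)
  qed
  have der: "((\<lambda>q. Im (Ln (g q / g p))) has_derivative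
      (\<lambda>w. Im ((fst w *\<^sub>R pdu g q + snd w *\<^sub>R pdv g q) / g q))) (at q)" if q: "q \<in> ball p r" for q
  proof -
    have d: "((\<lambda>q. g q / g p) has_derivative (\<lambda>w. (fst w *\<^sub>R pdu g q + snd w *\<^sub>R pdv g q) / g p)) (at q)"
      using bounded_linear.has_derivative[OF bounded_linear_divide has_derivative_pd[OF g]] q r by blast
    have "((\<lambda>q. Im (Ln (g q / g p))) has_derivative
        (\<lambda>w. Im (inverse (g q / g p) * ((fst w *\<^sub>R pdu g q + snd w *\<^sub>R pdv g q) / g p)))) (at q)"
      by (rule bounded_linear.has_derivative[OF bounded_linear_Im has_derivative_compose[OF d]])
        (rule has_field_derivative_Ln[OF slit[OF q], unfolded has_field_derivative_def])
    moreover have "inverse (g q / g p) * (x / g p) = x / g q" for x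
      using gp by (simp add: inverse_eq_divide)
    ultimately show ?thesis by simp
  qed
  show ?thesis
  proof (rule that[OF r])
    fix q0 a assume q0: "q0 \<in> ball p r" and a: "cis a = g q0"
    define L where "L q = Im (Ln (g q / g p)) + (a - Im (Ln (g q0 / g p)))" for q
    have cisL: "cis (L q) = g q" if q: "q \<in> ball p r" for q
    proof -
      have n1: "norm (g q / g p) = 1" "norm (g q0 / g p) = 1"
        using norm_g[of q] norm_g[of q0] subsetD[OF r(2) q] subsetD[OF r(2) q0] gp by (auto simp: norm_divide)
      have "cis (L q) = cis (Im (Ln (g q / g p))) * (cis a / cis (Im (Ln (g q0 / g p))))"
        by (simp add: L_def cis_mult cis_divide)
      also have "\<dots> = g q / g p * (g q0 / (g q0 / g p))"
        unfolding cis_Im_Ln[OF n1(1)] cis_Im_Ln[OF n1(2)] a ..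
      also have "\<dots> = g q" using n1 gp by auto
      finally show ?thesis .
    qed
    have derL: "(L has_derivative (\<lambda>w. Im ((fst w *\<^sub>R pdu g q + snd w *\<^sub>R pdv g q) / g q))) (at q)"
      if "q \<in> ball p r" for q
      unfolding L_def[abs_def] using has_derivative_add[OF der[OF that] has_derivative_const] by simp
    show "\<exists>L. L q0 = a \<and> (\<forall>q\<in>ball p r. cis (L q) = g q \<and>
      L differentiable at q \<and> (\<forall>V. dirD V L q = Im (dirD V g q / g q)))"
    proof (intro exI conjI ballI allI)
      show "L q0 = a" by (simp add: L_def)
      fix q V assume q: "q \<in> ball p r"
      show "cis (L q) = g q" by (rule cisL[OF q])
      show "L differentiable at q" by (rule differentiableI[OF derL[OF q]])
      show "dirD V L q = Im (dirD V g q / g q)"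
        unfolding dirD_eqI[OF derL[OF q]] dirD_def[of V g] ..
    qed
  qed
qed

text \<open>Equality case of the triangle inequality: the squares of \<open>z\<close> and
  \<open>w\<close> must both point along \<open>cis (2 * s)\<close>. After rotation by
  \<open>- s\<close> the two hypotheses differ by twice the sum of the squared imaginary
  parts.\<close>

lemma real_multiple_of_cis:
  assumes "(norm z)\<^sup>2 + (norm w)\<^sup>2 = 1" "z\<^sup>2 + w\<^sup>2 = cis (2 * s)"
  shows "z = Re (z * cis (- s)) *\<^sub>R cis s"
proof -
  define z' where "z' = z * cis (- s)"
  define w' where "w' = w * cis (- s)"
  have "z'\<^sup>2 + w'\<^sup>2 = (z\<^sup>2 + w\<^sup>2) * (cis (- s))\<^sup>2"
    by (simp add: z'_def w'_def power_mult_distrib algebra_simps)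
  also have "\<dots> = 1" unfolding assms(2) by (simp add: power2_eq_square cis_mult)
  finally have "Re (z'\<^sup>2 + w'\<^sup>2) = 1" by simp
  moreover have "(norm z')\<^sup>2 + (norm w')\<^sup>2 = 1"
    using assms(1) by (simp add: z'_def w'_def norm_mult)
  ultimately have "(Im z')\<^sup>2 + (Im w')\<^sup>2 = 0"
    unfolding cmod_power2 plus_complex.sel Re_power2 by linarith
  then have "Im z' = 0" by (simp add: sum_power2_eq_zero_iff)
  then have "z' = of_real (Re z')" by (simp add: complex_eq_iff)
  moreover have "z = z' * cis s" by (simp add: z'_def cis_mult)
  ultimately show ?thesis unfolding z'_def by (metis scaleR_conv_of_real)
qed

section \<open>Invariant planes and the complex coordinates on them\<close>

definition plane_coord :: "'a::real_inner \<Rightarrow> 'a \<Rightarrow> 'a \<Rightarrow> complex" where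
  "plane_coord E E' v = Complex (v \<bullet> E) (v \<bullet> E')"

lemma bounded_linear_plane_coord: "bounded_linear (plane_coord E E')"
proof -
  have eq: "plane_coord E E' = (\<lambda>v. of_real (v \<bullet> E) + \<i> * of_real (v \<bullet> E'))"
    by (rule ext) (simp add: plane_coord_def complex_eq_iff)
  show ?thesis unfolding eq
    by (intro bounded_linear_add bounded_linear_compose[OF bounded_linear_of_real] bounded_linear_inner_left
        bounded_linear_compose[OF bounded_linear_mult_right])
qed

context geodesic_asymptotic_frame
begin

lemma \<Omega>_normal_form:
  assumes p: "p \<in> U" and \<rho>: "\<rho> p \<noteq> 1"
  obtains \<alpha> \<beta> E1 E2 E3 E4 where "\<alpha> > 0" "\<beta> > 0" "\<alpha> \<noteq> \<beta>"
    "E1 \<bullet> E1 = 1" "E2 \<bullet> E2 = 1" "E3 \<bullet> E3 = 1" "E4 \<bullet> E4 = 1"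
    "E1 \<bullet> E2 = 0" "E1 \<bullet> E3 = 0" "E1 \<bullet> E4 = 0" "E2 \<bullet> E3 = 0" "E2 \<bullet> E4 = 0" "E3 \<bullet> E4 = 0"
    "\<Omega> p E1 = \<alpha> *\<^sub>R E2" "\<Omega> p E2 = - (\<alpha> *\<^sub>R E1)" "\<Omega> p E3 = \<beta> *\<^sub>R E4" "\<Omega> p E4 = - (\<beta> *\<^sub>R E3)"
    "f p \<bullet> E2 = 0" "e1 p \<bullet> E2 = 0" "(f p \<bullet> E1)\<^sup>2 + (e1 p \<bullet> E1)\<^sup>2 = 1"
    "f p \<bullet> E4 = 0" "e1 p \<bullet> E4 = 0" "(f p \<bullet> E3)\<^sup>2 + (e1 p \<bullet> E3)\<^sup>2 = 1"
proof -
  \<comment> \<open>The numbers \<open>a\<close>, \<open>b\<close>, \<open>d\<close> are the Gram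
    matrix of \<Omega> applied to \<open>f p\<close> and \<open>e1 p\<close>, hence the matrix of
    minus the square of \<Omega> on their span.\<close>
  define a where "a = (h p)\<^sup>2"
  define b where "b = (h p)\<^sup>2 * \<omega> p"
  define d where "d = (h p)\<^sup>2 * ((\<omega> p)\<^sup>2 + \<rho> p)"
  have h: "h p > 0" by (rule h_pos[OF p])
  have "a > 0" using h by (simp add: a_def)
  moreover have "a * d - b\<^sup>2 = (h p)\<^sup>2 * (h p)\<^sup>2 * \<rho> p"
    by (simp add: a_def b_def d_def power2_eq_square algebra_simps)
  then have "a * d - b\<^sup>2 > 0" using h \<rho>_pos[OF p] by simp
  \<comment> \<open>If \<open>b = 0\<close> then \<omega> vanishes at \<open>p\<close>, and
    \<open>a = d\<close> would force \<rho> to be 1 there. This is what separates the two rotation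
    speeds.\<close>
  moreover have "b \<noteq> 0 \<or> a \<noteq> d" using h \<rho> by (auto simp: a_def b_def d_def)
  ultimately obtain c s l k where cs: "c\<^sup>2 + s\<^sup>2 = 1" and lk: "l > 0" "k > 0" "l \<noteq> k"
    and eig: "a * c - b * s = l * c" "b * c - d * s = - l * s" "a * s + b * c = k * s" "b * s + d * c = k * c"
    using symmetric_2x2_diagonalizable[of a d b] by blast
  let ?O = "\<Omega> p"
  note lin = linear_add[OF linear_\<Omega>] linear_diff[OF linear_\<Omega>] linear_scale[OF linear_\<Omega>] linear_neg[OF linear_\<Omega>]
  have OOf: "?O (?O (f p)) = - (a *\<^sub>R f p + b *\<^sub>R e1 p)"
    by (simp add: \<Omega>_frame[OF p] lin a_def b_def power2_eq_square algebra_simps)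
  have OOe1: "?O (?O (e1 p)) = - (b *\<^sub>R f p + d *\<^sub>R e1 p)"
    by (simp add: \<Omega>_frame[OF p] lin b_def d_def power2_eq_square algebra_simps)
  define E1 where "E1 = c *\<^sub>R f p - s *\<^sub>R e1 p"
  define E3 where "E3 = s *\<^sub>R f p + c *\<^sub>R e1 p"
  have "?O (?O E1) = - ((a * c - b * s) *\<^sub>R f p + (b * c - d * s) *\<^sub>R e1 p)"
    by (simp add: E1_def lin OOf OOe1 algebra_simps)
  then have OOE1: "?O (?O E1) = - (l *\<^sub>R E1)" unfolding eig by (simp add: E1_def algebra_simps)
  have "?O (?O E3) = - ((a * s + b * c) *\<^sub>R f p + (b * s + d * c) *\<^sub>R e1 p)"
    by (simp add: E3_def lin OOf OOe1 algebra_simps)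
  then have OOE3: "?O (?O E3) = - (k *\<^sub>R E3)" unfolding eig by (simp add: E3_def algebra_simps)
  define E2 where "E2 = (1 / sqrt l) *\<^sub>R ?O E1"
  define E4 where "E4 = (1 / sqrt k) *\<^sub>R ?O E3"
  have ff: "f p \<bullet> f p = 1" "e1 p \<bullet> e1 p = 1" "f p \<bullet> e1 p = 0" "e1 p \<bullet> f p = 0"
    using unit_f[OF p] orthonormal[OF p] inner_f_e[OF p, of X] by (simp_all add: inner_commute)
  have E13: "E1 \<bullet> E1 = 1" "E3 \<bullet> E3 = 1" "E1 \<bullet> E3 = 0"
    using cs by (simp_all add: E1_def E3_def inner_add_left inner_add_right inner_diff_left inner_diff_right ff
        power2_eq_square algebra_simps)
  have Operp: "f p \<bullet> ?O (f p) = 0" "e1 p \<bullet> ?O (f p) = 0" "f p \<bullet> ?O (e1 p) = 0" "e1 p \<bullet> ?O (e1 p) = 0"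
    unfolding \<Omega>_frame[OF p] using inner_f_e[OF p] orthonormal[OF p] m_orthogonal[OF p]
    by (simp_all add: inner_add_left inner_add_right inner_commute)
  have perp: "f p \<bullet> E2 = 0" "e1 p \<bullet> E2 = 0" "f p \<bullet> E4 = 0" "e1 p \<bullet> E4 = 0"
    by (simp_all add: E1_def E2_def E3_def E4_def lin inner_add_right inner_diff_right Operp)
  have OO: "?O v \<bullet> ?O w = - (v \<bullet> ?O (?O w))" for v w by (rule \<Omega>_skew)
  have norm24: "E2 \<bullet> E2 = 1" "E4 \<bullet> E4 = 1" "E2 \<bullet> E4 = 0"
    using lk by (simp_all add: E2_def E4_def OO OOE1 OOE3 E13)
  show ?thesis
  proof (rule that[of "sqrt l" "sqrt k" E1 E2 E3 E4])
    show "E1 \<bullet> E2 = 0" "E1 \<bullet> E4 = 0" "E2 \<bullet> E3 = 0" "E3 \<bullet> E4 = 0"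
      unfolding E1_def E3_def using perp
      by (simp_all add: inner_add_left inner_add_right inner_diff_left inner_diff_right inner_commute)
    show "?O E1 = sqrt l *\<^sub>R E2" "?O E3 = sqrt k *\<^sub>R E4"
      using lk by (simp_all add: E2_def E4_def)
    show "?O E2 = - (sqrt l *\<^sub>R E1)" "?O E4 = - (sqrt k *\<^sub>R E3)"
      using lk by (simp_all add: E2_def E4_def lin OOE1 OOE3 real_div_sqrt)
    show "(f p \<bullet> E1)\<^sup>2 + (e1 p \<bullet> E1)\<^sup>2 = 1" "(f p \<bullet> E3)\<^sup>2 + (e1 p \<bullet> E3)\<^sup>2 = 1"
      using cs by (simp_all add: E1_def E3_def inner_add_right inner_diff_right ff add.commute)
  qed (use lk E13 norm24 perp in auto)
qed

text \<open>The projection of the plane spanned by \<open>f, e1\<close> to an invariant plane of \<open>\<Omega>\<close> is a line. The sum of squares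
  below is the square of its direction, hence a smooth function free of the choice of sign.\<close>

definition "phase E E' p = (plane_coord E E' (f p))\<^sup>2 + (plane_coord E E' (e1 p))\<^sup>2"

lemma phase_differentiable:
  assumes p: "p \<in> U" shows "phase E E' differentiable at p"
proof -
  have "surf_smooth_on U (\<lambda>p. plane_coord E E' (f p) * plane_coord E E' (f p)
      + plane_coord E E' (e1 p) * plane_coord E E' (e1 p))"
    by (intro surf_smooth_on_add surf_smooth_on_mult surf_smooth_on_linear[OF _ bounded_linear_plane_coord]
        open_U smooth_f smooth_frame)
  then show ?thesis
    unfolding phase_def[abs_def] power2_eq_square by (rule surf_smooth_on_differentiable[OF _ p])
qed

section \<open>One invariant plane: components along \<open>Y\<close>, phase and first
  integrals\<close>

context
  fixes p0 E E' and \<alpha> :: real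
  assumes p0: "p0 \<in> U" and OE: "\<Omega> p0 E = \<alpha> *\<^sub>R E'" "\<Omega> p0 E' = - (\<alpha> *\<^sub>R E)"
    and base: "f p0 \<bullet> E' = 0" "e1 p0 \<bullet> E' = 0" "(f p0 \<bullet> E)\<^sup>2 + (e1 p0 \<bullet> E)\<^sup>2 = 1"
begin

text \<open>Skewness moves \<Omega> onto the fixed vectors, and constancy lets its action on them be
  taken at \<open>p0\<close>.\<close>

lemma dirD_Y_components:
  assumes p: "p \<in> U"
  shows "e2 p \<bullet> E = - (\<alpha> / h p) * (f p \<bullet> E')" "e2 p \<bullet> E' = (\<alpha> / h p) * (f p \<bullet> E)"
    "dirD Y e1 p \<bullet> E = - (\<alpha> / h p) * (e1 p \<bullet> E')" "dirD Y e1 p \<bullet> E' = (\<alpha> / h p) * (e1 p \<bullet> E)"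
proof -
  have \<Omega>p: "\<Omega> p v = \<Omega> p0 v" for v by (rule \<Omega>_constant[OF p p0])
  have "h p * (e2 p \<bullet> v) = - (f p \<bullet> \<Omega> p0 v)" "h p * (dirD Y e1 p \<bullet> v) = - (e1 p \<bullet> \<Omega> p0 v)" for v
    using \<Omega>_skew[of p "f p" v] \<Omega>_skew[of p "e1 p" v] \<Omega>_frame(1,2)[OF p] \<Omega>p[of v] dirD_Y_e1[OF p] by simp_all
  from this[of E] this[of E'] show "e2 p \<bullet> E = - (\<alpha> / h p) * (f p \<bullet> E')" "e2 p \<bullet> E' = (\<alpha> / h p) * (f p \<bullet> E)"
    "dirD Y e1 p \<bullet> E = - (\<alpha> / h p) * (e1 p \<bullet> E')" "dirD Y e1 p \<bullet> E' = (\<alpha> / h p) * (e1 p \<bullet> E)"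
    unfolding OE using h_pos[OF p] by (simp_all add: field_simps)
qed

text \<open>Write \<open>z\<close> and \<open>w\<close> for the plane coordinates of
  \<open>f\<close> and \<open>e1\<close>. Along \<open>X\<close> the pair has derivative
  \<open>(w, - z)\<close>, so the two contributions cancel; along \<open>Y\<close> both are
  multiplied by the same imaginary number.\<close>

lemma dirD_phase:
  assumes p: "p \<in> U"
  shows "dirD X (phase E E') p = 0" "dirD Y (phase E E') p = 2 * \<i> * of_real (\<alpha> / h p) * phase E E' p"
proof -
  note d = frame_differentiable[OF p]
  note bl = bounded_linear_plane_coord[of E E']
  have D: "dirD V (phase E E') p = 2 * plane_coord E E' (f p) * plane_coord E E' (dirD V f p)
      + 2 * plane_coord E E' (e1 p) * plane_coord E E' (dirD V e1 p)" for V
  proof -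
    have dd: "(\<lambda>p. plane_coord E E' (f p)) differentiable at p" "(\<lambda>p. plane_coord E E' (e1 p)) differentiable at p"
      using surf_smooth_on_linear[OF open_U bl] smooth_f smooth_frame surf_smooth_on_differentiable p by blast+
    show ?thesis
      unfolding phase_def[abs_def] power2_eq_square
      by (subst dirD_add) (auto simp: dirD_mult dd dirD_bounded_linear[OF bl] d intro!: derivative_intros)
  qed
  have "plane_coord E E' (- f p) = - plane_coord E E' (f p)" by (simp add: plane_coord_def complex_eq_iff)
  then show "dirD X (phase E E') p = 0" unfolding D geodesic[OF p] by simp
  have "plane_coord E E' (e2 p) = \<i> * of_real (\<alpha> / h p) * plane_coord E E' (f p)"
    "plane_coord E E' (dirD Y e1 p) = \<i> * of_real (\<alpha> / h p) * plane_coord E E' (e1 p)"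
    unfolding plane_coord_def dirD_Y_components[OF p] by (simp_all add: complex_eq_iff)
  then show "dirD Y (phase E E') p = 2 * \<i> * of_real (\<alpha> / h p) * phase E E' p"
    unfolding D phase_def by (simp add: power2_eq_square algebra_simps)
qed

text \<open>With \<open>z\<close> and \<open>w\<close> as plane coordinates of \<open>f\<close> and
  \<open>e1\<close>, \<open>N\<close> is the total squared length and \<open>P\<close> the oriented
  area they span. \<open>X\<close> rotates the pair and \<open>Y\<close> rotates the plane, so both
  are constant. Their base values 1 and 0 give the norm of the phase by the identity for the sum of
  two complex squares.\<close>

lemma plane_invariants:
  assumes p: "p \<in> U"
  shows "(norm (plane_coord E E' (f p)))\<^sup>2 + (norm (plane_coord E E' (e1 p)))\<^sup>2 = 1" "norm (phase E E' p) = 1"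
proof -
  define N where "N p = (f p \<bullet> E) * (f p \<bullet> E) + (f p \<bullet> E') * (f p \<bullet> E') + (e1 p \<bullet> E) * (e1 p \<bullet> E)
    + (e1 p \<bullet> E') * (e1 p \<bullet> E')" for p
  define P where "P p = (f p \<bullet> E) * (e1 p \<bullet> E') - (f p \<bullet> E') * (e1 p \<bullet> E)" for p
  have smN: "surf_smooth_on U N" and smP: "surf_smooth_on U P"
    unfolding N_def[abs_def] P_def[abs_def]
    by (intro surf_smooth_on_add surf_smooth_on_diff surf_smooth_on_mult surf_smooth_on_inner surf_smooth_on_const
        open_U smooth_f smooth_frame)+
  have dd: "(\<lambda>q. g q \<bullet> v) differentiable at p" if "g differentiable at p" for g :: "real \<times> real \<Rightarrow> real^4" and p v
    using that by (auto simp: differentiable_def intro: has_derivative_inner_left)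
  have D: "dirD V N p = 2 * ((f p \<bullet> E) * (dirD V f p \<bullet> E) + (f p \<bullet> E') * (dirD V f p \<bullet> E')
      + (e1 p \<bullet> E) * (dirD V e1 p \<bullet> E) + (e1 p \<bullet> E') * (dirD V e1 p \<bullet> E'))"
    "dirD V P p = (dirD V f p \<bullet> E) * (e1 p \<bullet> E') + (f p \<bullet> E) * (dirD V e1 p \<bullet> E')
      - (dirD V f p \<bullet> E') * (e1 p \<bullet> E) - (f p \<bullet> E') * (dirD V e1 p \<bullet> E)" if p: "p \<in> U" for p V
    unfolding N_def[abs_def] P_def[abs_def] using frame_differentiable[OF p]
    by (simp_all add: dirD_add dirD_diff dirD_mult dirD_inner dirD_const dd)
  have "N p = N p0"
  proof (rule constant_if_dirD_zero[OF open_U connected_U _ _ _ independent p p0])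
    show "dirD X N p = 0" if "p \<in> U" for p
      using that by (simp add: D geodesic)
    show "dirD Y N p = 0" if "p \<in> U" for p
      using that unfolding D[OF that] dirD_Y_components[OF that] by (simp add: algebra_simps)
  qed (use smN surf_smooth_on_differentiable in auto)
  moreover have "N p0 = 1" using base by (simp add: N_def power2_eq_square)
  ultimately have N: "N p = 1" by simp
  have "P p = P p0"
  proof (rule constant_if_dirD_zero[OF open_U connected_U _ _ _ independent p p0])
    show "dirD X P p = 0" if "p \<in> U" for p
      using that by (simp add: D geodesic)
    show "dirD Y P p = 0" if "p \<in> U" for p
      using that unfolding D[OF that] dirD_Y_components[OF that] by (simp add: algebra_simps)
  qed (use smP surf_smooth_on_differentiable in auto)
  then have P: "P p = 0" using base by (simp add: P_def)
  show "(norm (plane_coord E E' (f p)))\<^sup>2 + (norm (plane_coord E E' (e1 p)))\<^sup>2 = 1"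
    unfolding plane_coord_def cmod_power2 using N by (simp add: N_def power2_eq_square)
  have "(norm (phase E E' p))\<^sup>2 = (N p)\<^sup>2 - 4 * (P p)\<^sup>2"
    unfolding phase_def plane_coord_def cmod_power2 N_def P_def
    by (simp add: power2_eq_square algebra_simps)
  then have "(norm (phase E E' p))\<^sup>2 = 1\<^sup>2" using N P by simp
  then show "norm (phase E E' p) = 1" by (rule power2_eq_imp_eq) auto
qed

lemma phase_base: "phase E E' p0 = 1"
  using base by (simp add: phase_def plane_coord_def complex_eq_iff power2_eq_square)

end

end

section \<open>Compatible angles and the Lawson parametrization\<close>

lemma vector_4:
  "(vector [w, x, y, z] :: 'a::zero^4) $ 1 = w" "(vector [w, x, y, z] :: 'a^4) $ 2 = x"
  "(vector [w, x, y, z] :: 'a^4) $ 3 = y" "(vector [w, x, y, z] :: 'a^4) $ 4 = z"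
  unfolding vector_def by simp_all

definition axes_map :: "real^4 \<Rightarrow> real^4 \<Rightarrow> real^4 \<Rightarrow> real^4 \<Rightarrow> real^4 \<Rightarrow> real^4" where
  "axes_map E1 E2 E3 E4 v = v $ 1 *\<^sub>R E1 + v $ 2 *\<^sub>R E2 + v $ 3 *\<^sub>R E3 + v $ 4 *\<^sub>R E4"

lemma orthogonal_axes_map:
  assumes "E1 \<bullet> E1 = 1" "E2 \<bullet> E2 = 1" "E3 \<bullet> E3 = 1" "E4 \<bullet> E4 = 1"
    "E1 \<bullet> E2 = 0" "E1 \<bullet> E3 = 0" "E1 \<bullet> E4 = 0" "E2 \<bullet> E3 = 0" "E2 \<bullet> E4 = 0" "E3 \<bullet> E4 = 0"
  shows "orthogonal_transformation (axes_map E1 E2 E3 E4)"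
proof -
  have "linear (axes_map E1 E2 E3 E4)"
    by (rule linearI) (simp_all add: axes_map_def algebra_simps)
  moreover have "axes_map E1 E2 E3 E4 v \<bullet> axes_map E1 E2 E3 E4 w = v \<bullet> w" for v w
  proof -
    have "axes_map E1 E2 E3 E4 v \<bullet> axes_map E1 E2 E3 E4 w = v $ 1 * w $ 1 + v $ 2 * w $ 2 + v $ 3 * w $ 3 + v $ 4 * w $ 4"
      unfolding axes_map_def using assms by (simp add: inner_add_left inner_add_right inner_commute)
    then show ?thesis by (simp add: inner_vec_def sum_4)
  qed
  ultimately show ?thesis unfolding orthogonal_transformation_def by blast
qed

context geodesic_asymptotic_frame
begin

context
  fixes p0 E1 E2 E3 E4 and \<alpha> \<beta> :: real
  assumes p0: "p0 \<in> U" and pos: "\<alpha> > 0" "\<beta> > 0"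
    and E: "E1 \<bullet> E1 = 1" "E2 \<bullet> E2 = 1" "E3 \<bullet> E3 = 1" "E4 \<bullet> E4 = 1"
    "E1 \<bullet> E2 = 0" "E1 \<bullet> E3 = 0" "E1 \<bullet> E4 = 0" "E2 \<bullet> E3 = 0" "E2 \<bullet> E4 = 0" "E3 \<bullet> E4 = 0"
    and O1: "\<Omega> p0 E1 = \<alpha> *\<^sub>R E2" "\<Omega> p0 E2 = - (\<alpha> *\<^sub>R E1)"
    and O2: "\<Omega> p0 E3 = \<beta> *\<^sub>R E4" "\<Omega> p0 E4 = - (\<beta> *\<^sub>R E3)"
    and base1: "f p0 \<bullet> E2 = 0" "e1 p0 \<bullet> E2 = 0" "(f p0 \<bullet> E1)\<^sup>2 + (e1 p0 \<bullet> E1)\<^sup>2 = 1"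
    and base2: "f p0 \<bullet> E4 = 0" "e1 p0 \<bullet> E4 = 0" "(f p0 \<bullet> E3)\<^sup>2 + (e1 p0 \<bullet> E3)\<^sup>2 = 1"
begin

text \<open>Each phase fixes its angle only modulo pi; the linear relation selects branches that
  match the ratio of angles in \<open>lawson (\<alpha> / \<beta>)\<close>.\<close>

definition "lawson_phases s t q \<longleftrightarrow>
  cis (2 * s) = phase E1 E2 q \<and> cis (2 * t) = phase E3 E4 q \<and> \<beta> * s = \<alpha> * t"

text \<open>The lifted doubled angles are constant along \<open>X\<close> and change along
  \<open>Y\<close> at rates \<open>2 * \<alpha> / h\<close> and \<open>2 * \<beta> / h\<close>, so
  the linear relation persists on the ball once it holds at one point.\<close>

lemma lawson_phases_lift:
  assumes p: "p \<in> U"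
  obtains r where "r > 0" "ball p r \<subseteq> U" "\<And>q0 s0 t0. q0 \<in> ball p r \<Longrightarrow> lawson_phases s0 t0 q0 \<Longrightarrow>
    \<exists>s t. continuous_on (ball p r) s \<and> continuous_on (ball p r) t \<and> (\<forall>q\<in>ball p r. lawson_phases (s q) (t q) q)"
proof -
  note ph1 = phase_differentiable dirD_phase[OF p0 O1 base1] plane_invariants(2)[OF p0 O1 base1]
  note ph2 = phase_differentiable dirD_phase[OF p0 O2 base2] plane_invariants(2)[OF p0 O2 base2]
  obtain r1 where r1: "r1 > 0" "ball p r1 \<subseteq> U" and lift1:
    "\<And>q0 a. q0 \<in> ball p r1 \<Longrightarrow> cis a = phase E1 E2 q0 \<Longrightarrow> \<exists>L. L q0 = a \<and> (\<forall>q\<in>ball p r1. cis (L q) = phase E1 E2 q \<and>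
      L differentiable at q \<and> (\<forall>V. dirD V L q = Im (dirD V (phase E1 E2) q / phase E1 E2 q)))"
    using phase_lift[OF open_U p phase_differentiable ph1(4)] by blast
  obtain r2 where r2: "r2 > 0" "ball p r2 \<subseteq> U" and lift2:
    "\<And>q0 a. q0 \<in> ball p r2 \<Longrightarrow> cis a = phase E3 E4 q0 \<Longrightarrow> \<exists>L. L q0 = a \<and> (\<forall>q\<in>ball p r2. cis (L q) = phase E3 E4 q \<and>
      L differentiable at q \<and> (\<forall>V. dirD V L q = Im (dirD V (phase E3 E4) q / phase E3 E4 q)))"
    using phase_lift[OF open_U p phase_differentiable ph2(4)] by blast
  define r where "r = min r1 r2"
  have sub: "ball p r \<subseteq> ball p r1" "ball p r \<subseteq> ball p r2" by (auto simp: r_def)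
  show ?thesis
  proof (rule that)
    show "r > 0" using r1 r2 by (simp add: r_def)
    show rU: "ball p r \<subseteq> U" using sub r1 by blast
    fix q0 s0 t0 assume q0: "q0 \<in> ball p r" and ph: "lawson_phases s0 t0 q0"
    from ph have ph': "cis (2 * s0) = phase E1 E2 q0" "cis (2 * t0) = phase E3 E4 q0" "\<beta> * s0 = \<alpha> * t0"
      by (auto simp: lawson_phases_def)
    obtain S where S: "S q0 = 2 * s0" "\<And>q. q \<in> ball p r \<Longrightarrow> cis (S q) = phase E1 E2 q"
        "\<And>q. q \<in> ball p r \<Longrightarrow> S differentiable at q"
        "\<And>q V. q \<in> ball p r \<Longrightarrow> dirD V S q = Im (dirD V (phase E1 E2) q / phase E1 E2 q)"
      using lift1[of q0 "2 * s0"] q0 sub ph' by blast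
    obtain T where T: "T q0 = 2 * t0" "\<And>q. q \<in> ball p r \<Longrightarrow> cis (T q) = phase E3 E4 q"
        "\<And>q. q \<in> ball p r \<Longrightarrow> T differentiable at q"
        "\<And>q V. q \<in> ball p r \<Longrightarrow> dirD V T q = Im (dirD V (phase E3 E4) q / phase E3 E4 q)"
      using lift2[of q0 "2 * t0"] q0 sub ph' by blast
    have dS: "dirD X S q = 0" "dirD Y S q = 2 * \<alpha> / h q" and dT: "dirD X T q = 0" "dirD Y T q = 2 * \<beta> / h q"
      if q: "q \<in> ball p r" for q
    proof -
      have qU: "q \<in> U" using q rU by blast
      have "phase E1 E2 q \<noteq> 0" "phase E3 E4 q \<noteq> 0" using ph1(4)[OF qU] ph2(4)[OF qU] by auto
      then show "dirD X S q = 0" "dirD Y S q = 2 * \<alpha> / h q" "dirD X T q = 0" "dirD Y T q = 2 * \<beta> / h q"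
        using S(4)[OF q] T(4)[OF q] ph1(2,3)[OF qU] ph2(2,3)[OF qU] by simp_all
    qed
    have const: "\<beta> * S q - \<alpha> * T q = \<beta> * S q0 - \<alpha> * T q0" if q: "q \<in> ball p r" for q
    proof (rule constant_if_dirD_zero[OF open_ball connected_ball _ _ _ _ q q0])
      fix x assume x: "x \<in> ball p r"
      have d: "(\<lambda>q. \<beta> * S q) differentiable at x" "(\<lambda>q. \<alpha> * T q) differentiable at x"
        using S(3)[OF x] T(3)[OF x] by (auto intro!: derivative_intros)
      then show "(\<lambda>q. \<beta> * S q - \<alpha> * T q) differentiable at x" by (rule differentiable_diff)
      have D: "dirD V (\<lambda>q. \<beta> * S q - \<alpha> * T q) x = \<beta> * dirD V S x - \<alpha> * dirD V T x" for V
        using d S(3)[OF x] T(3)[OF x] by (simp add: dirD_diff dirD_mult dirD_const)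
      show "dirD X (\<lambda>q. \<beta> * S q - \<alpha> * T q) x = 0" "dirD Y (\<lambda>q. \<beta> * S q - \<alpha> * T q) x = 0"
        unfolding D using dS[OF x] dT[OF x] by simp_all
      show "fst (X x) * snd (Y x) - snd (X x) * fst (Y x) \<noteq> 0" using x rU by (intro independent) blast
    qed
    have "lawson_phases (S q / 2) (T q / 2) q" if q: "q \<in> ball p r" for q
    proof -
      have "\<beta> * (2 * s0) = \<alpha> * (2 * t0)" using ph'(3) by simp
      then show ?thesis using const[OF q] S(1) S(2)[OF q] T(1) T(2)[OF q] by (simp add: lawson_phases_def)
    qed
    moreover have "continuous_on (ball p r) (\<lambda>q. S q / 2)" "continuous_on (ball p r) (\<lambda>q. T q / 2)"
      by (intro continuous_intros differentiable_imp_continuous_on differentiable_at_imp_differentiable_on S(3) T(3);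
          simp)+
    ultimately show "\<exists>s t. continuous_on (ball p r) s \<and> continuous_on (ball p r) t \<and>
      (\<forall>q\<in>ball p r. lawson_phases (s q) (t q) q)" by blast
  qed
qed

text \<open>Existence of a compatible pair is a locally constant property, true at \<open>p0\<close>
  with both angles 0. Connectedness spreads it without requiring the branches to agree around
  loops.\<close>

lemma lawson_phases_exist:
  assumes p: "p \<in> U"
  shows "\<exists>s t. lawson_phases s t p"
proof -
  have "(\<exists>s t. lawson_phases s t p) = (\<exists>s t. lawson_phases s t p0)"
  proof (rule connected_local_const[OF connected_U p p0, where f = "\<lambda>q. \<exists>s t. lawson_phases s t q"], intro ballI)
    fix a assume a: "a \<in> U"
    obtain r where r: "r > 0" "ball a r \<subseteq> U" "\<And>q0 s0 t0. q0 \<in> ball a r \<Longrightarrow> lawson_phases s0 t0 q0 \<Longrightarrow>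
      \<exists>s t. continuous_on (ball a r) s \<and> continuous_on (ball a r) t \<and> (\<forall>q\<in>ball a r. lawson_phases (s q) (t q) q)"
      using lawson_phases_lift[OF a] by blast
    have "(\<exists>s t. lawson_phases s t a) = (\<exists>s t. lawson_phases s t b)" if b: "b \<in> ball a r" for b
      using r(1) r(3)[OF b] r(3)[of a] b by (metis centre_in_ball)
    moreover have "\<forall>\<^sub>F b in at a within U. b \<in> ball a r"
      using r(1) by (auto simp: eventually_at_topological intro!: exI[of _ "ball a r"])
    ultimately show "\<forall>\<^sub>F b in at a within U. (\<exists>s t. lawson_phases s t a) = (\<exists>s t. lawson_phases s t b)"
      by (rule eventually_mono[rotated])
  qed
  moreover have "lawson_phases 0 0 p0"
    using phase_base[OF p0 O1 base1] phase_base[OF p0 O2 base2] by (simp add: lawson_phases_def)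
  ultimately show ?thesis by blast
qed

lemma locally_lawson:
  assumes p: "p \<in> U"
  shows "\<exists>W. open W \<and> p \<in> W \<and> W \<subseteq> U \<and> (\<exists>\<phi> :: real \<times> real \<Rightarrow> real \<times> real. continuous_on W \<phi> \<and>
    (\<forall>q\<in>W. f q = axes_map E1 E2 E3 E4 (lawson (\<alpha> / \<beta>) (\<phi> q))))"
proof -
  obtain r where r: "r > 0" "ball p r \<subseteq> U" "\<And>q0 s0 t0. q0 \<in> ball p r \<Longrightarrow> lawson_phases s0 t0 q0 \<Longrightarrow>
      \<exists>s t. continuous_on (ball p r) s \<and> continuous_on (ball p r) t \<and> (\<forall>q\<in>ball p r. lawson_phases (s q) (t q) q)"
    using lawson_phases_lift[OF p] by blast
  have pr: "p \<in> ball p r" using r by simp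
  obtain s0 t0 where "lawson_phases s0 t0 p" using lawson_phases_exist[OF p] by blast
  from r(3)[OF pr this] obtain s t where cont: "continuous_on (ball p r) s" "continuous_on (ball p r) t"
    and st: "\<And>q. q \<in> ball p r \<Longrightarrow> lawson_phases (s q) (t q) q" by blast
  \<comment> \<open>Signed radii: \<open>a\<close> and \<open>b\<close> may change sign, so they are
    kept as real multiples of \<open>cis\<close> rather than as absolute values.\<close>
  define a where "a q = Re (plane_coord E1 E2 (f q) * cis (- s q))" for q
  define b where "b q = Re (plane_coord E3 E4 (f q) * cis (- t q))" for q
  have a: "plane_coord E1 E2 (f q) = a q *\<^sub>R cis (s q)" and b: "plane_coord E3 E4 (f q) = b q *\<^sub>R cis (t q)"
    if q: "q \<in> ball p r" for q
  proof -
    have qU: "q \<in> U" using q r by blast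
    show "plane_coord E1 E2 (f q) = a q *\<^sub>R cis (s q)" unfolding a_def
      using plane_invariants(1)[OF p0 O1 base1 qU] st[OF q]
      by (intro real_multiple_of_cis) (auto simp: lawson_phases_def phase_def)
    show "plane_coord E3 E4 (f q) = b q *\<^sub>R cis (t q)" unfolding b_def
      using plane_invariants(1)[OF p0 O2 base2 qU] st[OF q]
      by (intro real_multiple_of_cis) (auto simp: lawson_phases_def phase_def)
  qed
  have comps: "f q \<bullet> E1 = a q * cos (s q)" "f q \<bullet> E2 = a q * sin (s q)"
      "f q \<bullet> E3 = b q * cos (t q)" "f q \<bullet> E4 = b q * sin (t q)" if q: "q \<in> ball p r" for q
    using a[OF q] b[OF q] by (simp_all add: plane_coord_def complex_eq_iff)
  have f_eq: "f q = (f q \<bullet> E1) *\<^sub>R E1 + (f q \<bullet> E2) *\<^sub>R E2 + (f q \<bullet> E3) *\<^sub>R E3 + (f q \<bullet> E4) *\<^sub>R E4" for q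
    by (rule orthonormal4_eqI[OF E]) (use E in \<open>simp_all add: inner_add_left inner_add_right inner_commute\<close>)
  have ab: "(a q)\<^sup>2 + (b q)\<^sup>2 = 1" if q: "q \<in> ball p r" for q
  proof -
    have "1 = f q \<bullet> f q" using unit_f q r by (simp add: subset_eq)
    also have "\<dots> = f q \<bullet> ((f q \<bullet> E1) *\<^sub>R E1 + (f q \<bullet> E2) *\<^sub>R E2 + (f q \<bullet> E3) *\<^sub>R E3 + (f q \<bullet> E4) *\<^sub>R E4)"
      by (subst (2) f_eq) (rule refl)
    also have "\<dots> = (a q)\<^sup>2 * ((cos (s q))\<^sup>2 + (sin (s q))\<^sup>2) + (b q)\<^sup>2 * ((cos (t q))\<^sup>2 + (sin (t q))\<^sup>2)"
      unfolding inner_add_right inner_scaleR_right comps[OF q] by algebra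
    finally show ?thesis by simp
  qed
  have cont_f: "continuous_on (ball p r) f"
    using smooth_f surf_smooth_on_differentiable r
    by (intro differentiable_imp_continuous_on differentiable_at_imp_differentiable_on) blast
  have pc: "plane_coord E E' = (\<lambda>v. Complex (v \<bullet> E) (v \<bullet> E'))" for E E' by (rule ext) (simp add: plane_coord_def)
  have "continuous_on (ball p r) a" "continuous_on (ball p r) b"
    unfolding a_def[abs_def] b_def[abs_def] pc Complex_eq cis_conv_exp
    by (intro continuous_intros cont cont_f)+
  then have "continuous_on (ball p r) (\<lambda>q. Complex (a q) (b q))"
    unfolding Complex_eq by (intro continuous_intros)
  moreover have "Complex (a q) (b q) \<noteq> 0" if "q \<in> ball p r" for q
    using ab[OF that] by (auto simp: complex_eq_iff)
  \<comment> \<open>The pair \<open>(a, b)\<close> moves on the unit circle, and a continuous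
    logarithm on the ball supplies the angle \<open>x\<close> even where a radius changes
    sign.\<close>
  ultimately obtain l where l: "continuous_on (ball p r) l" "\<And>q. q \<in> ball p r \<Longrightarrow> Complex (a q) (b q) = exp (l q)"
    using continuous_logarithm_on_ball by blast
  have x: "a q = cos (Im (l q))" "b q = sin (Im (l q))" if q: "q \<in> ball p r" for q
  proof -
    have "norm (exp (l q)) = 1"
      using ab[OF q] unfolding l(2)[OF q, symmetric] by (simp add: cmod_def)
    then have "Re (l q) = 0" by (simp add: norm_exp_eq_Re)
    then have "Complex (a q) (b q) = cis (Im (l q))"
      unfolding l(2)[OF q] by (simp add: exp_eq_polar)
    then show "a q = cos (Im (l q))" "b q = sin (Im (l q))" by (simp_all add: complex_eq_iff)
  qed
  show ?thesis
  proof (intro exI[of _ "ball p r"] conjI exI[of _ "\<lambda>q. (Im (l q), t q)"] ballI)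
    show "continuous_on (ball p r) (\<lambda>q. (Im (l q), t q))"
      by (intro continuous_intros l cont)
    fix q assume q: "q \<in> ball p r"
    have "s q = \<alpha> / \<beta> * t q" using st[OF q] pos by (simp add: lawson_phases_def field_simps)
    then show "f q = axes_map E1 E2 E3 E4 (lawson (\<alpha> / \<beta>) (Im (l q), t q))"
      by (subst f_eq) (simp add: axes_map_def lawson_def Let_def vector_4 comps[OF q] x[OF q])
  qed (use r in auto)
qed

end

end

theorem theorem2p3:
  fixes U :: "(real \<times> real) set" and f n :: "real \<times> real \<Rightarrow> real^4"
  assumes "gen_torus_first_type U f n"
    and "\<exists>p\<in>U. \<exists>q\<in>U. gauss_curv f n p \<noteq> gauss_curv f n q"
  shows "\<exists>\<alpha>::real. \<alpha> > 0 \<and> \<alpha> \<noteq> 1 \<and>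
           (\<exists>Q :: real^4 \<Rightarrow> real^4. orthogonal_transformation Q \<and>
              (\<forall>p\<in>U. \<exists>W. open W \<and> p \<in> W \<and> W \<subseteq> U \<and>
                 (\<exists>\<phi> :: real \<times> real \<Rightarrow> real \<times> real. continuous_on W \<phi> \<and>
                    (\<forall>q\<in>W. f q = Q (lawson \<alpha> (\<phi> q))))))"
proof -
  obtain X Y where fr: "geodesic_asymptotic_frame U f n X Y"
    and K: "\<And>p. p \<in> U \<Longrightarrow> gauss_curv f n p = 1 - (dirD X (dirD Y f) p \<bullet> n p)\<^sup>2"
    using gen_torus_frame[OF assms(1)] by blast
  interpret geodesic_asymptotic_frame U f n X Y by (rule fr)
  \<comment> \<open>A nonconstant curvature is nonzero somewhere; since \<rho> is 1 minus the
    curvature, the normal form with distinct speeds is available at that point.\<close>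
  obtain p0 where p0: "p0 \<in> U" and "gauss_curv f n p0 \<noteq> 0" using assms(2) by metis
  then have \<rho>: "\<rho> p0 \<noteq> 1" by (simp add: K \<rho>_eq)
  obtain \<alpha> \<beta> E1 E2 E3 E4 where *: "\<alpha> > 0" "\<beta> > 0" "\<alpha> \<noteq> \<beta>"
    "E1 \<bullet> E1 = 1" "E2 \<bullet> E2 = 1" "E3 \<bullet> E3 = 1" "E4 \<bullet> E4 = 1"
    "E1 \<bullet> E2 = 0" "E1 \<bullet> E3 = 0" "E1 \<bullet> E4 = 0" "E2 \<bullet> E3 = 0" "E2 \<bullet> E4 = 0" "E3 \<bullet> E4 = 0"
    "\<Omega> p0 E1 = \<alpha> *\<^sub>R E2" "\<Omega> p0 E2 = - (\<alpha> *\<^sub>R E1)" "\<Omega> p0 E3 = \<beta> *\<^sub>R E4" "\<Omega> p0 E4 = - (\<beta> *\<^sub>R E3)"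
    "f p0 \<bullet> E2 = 0" "e1 p0 \<bullet> E2 = 0" "(f p0 \<bullet> E1)\<^sup>2 + (e1 p0 \<bullet> E1)\<^sup>2 = 1"
    "f p0 \<bullet> E4 = 0" "e1 p0 \<bullet> E4 = 0" "(f p0 \<bullet> E3)\<^sup>2 + (e1 p0 \<bullet> E3)\<^sup>2 = 1"
    by (rule \<Omega>_normal_form[OF p0 \<rho>]) (rule that)
  show ?thesis
  proof (intro exI[of _ "\<alpha> / \<beta>"] conjI exI[of _ "axes_map E1 E2 E3 E4"] ballI)
    show "\<alpha> / \<beta> > 0" "\<alpha> / \<beta> \<noteq> 1" using * by simp_all
    show "orthogonal_transformation (axes_map E1 E2 E3 E4)" by (rule orthogonal_axes_map[OF *(4-13)])
  qed (rule locally_lawson[OF p0 *(1,2,4-)])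
qed

end
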